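(* Let $\mathcal H$ be a finite-dimensional complex Hilbert space, let $1<p<\infty$, and let $\mathcal K$ be a subset of the set of Lindbladians on $\mathbb B(\mathcal H)$. Fix $\sigma\in\mathcal D(\mathcal H)$ and for $\varepsilon>0$ let $B_{\sigma,\varepsilon}=\{\eta\in\mathcal D(\mathcal H):\|\sigma-\eta\|_p<\varepsilon\}$. Suppose there exists $\varepsilon>0$ such that $B_{\sigma,\varepsilon}$ is strictly contained in $\mathcal D(\mathcal H)$ (i.e. $B_{\sigma,\varepsilon}\subsetneq\mathcal D(\mathcal H)$) and such that for all $\eta\in\partial B_{\sigma,\varepsilon}\cap\mathcal D(\mathcal H)$ and all $L\in\mathcal K$, $$\mathrm{tr}\big(L(\eta)\,(\eta-\sigma)\,|\eta-\sigma|^{p-2}\big)\ge 0 .$$ Then $\mathcal K$ does not reach $\sigma$.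
   Context: $\mathbb B(\mathcal H)$ is the algebra of linear operators on $\mathcal H$; $\mathcal D(\mathcal H)=\{\rho\in\mathbb B(\mathcal H):\rho=\rho^*,\rho\ge 0,\mathrm{tr}\,\rho=1\}$. $\|x\|_p=(\mathrm{tr}|x|^p)^{1/p}$. For Hermitian $x$, $x|x|^{p-2}$ is defined by functional calculus from $s\mapsto \mathrm{sgn}(s)|s|^{p-1}$. The boundary is $\partial B_{\sigma,\varepsilon}\cap\mathcal D(\mathcal H)=\{\eta\in\mathcal D(\mathcal H):\|\sigma-\eta\|_p=\varepsilon\}$. A Lindbladian is a linear map on $\mathbb B(\mathcal H)$ of the form $L(\rho)=-i[H,\rho]+\sum_{j=1}^n\big(L_j\rho L_j^*-\tfrac12(L_j^*L_j\rho+\rho L_j^*L_j)\big)$ with $H=H^*$ and $L_j\in\mathbb B(\mathcal H)$. An evolution $(T_t)_{t\ge 0}$ (maps on $\mathbb B(\mathcal H)$ with $T_0=\mathrm{id}$) is admissible to $\mathcal K$ if there is a family $L_t\in\mathcal K$, for all $t$, such that $T_t$ is a weak solution of $\dot T_t=L_tT_t$. $\mathcal K$ reaches $\sigma$ if for every initial state $\rho\in\mathcal D(\mathcal H)$ there is a time-dependent Lindbladian evolution $T_t$ admissible to $\mathcal K$ with $\lim_{t\to\infty}T_t(\rho)=\sigma$.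
   Formalization: The strict containment of the ball in D(H) is strengthened to strict containment of its closure, i.e. some state has p-distance greater than ε from σ; this excludes only ε equal to the maximal distance, where the claim fails (qubit, σ=|0><0|, ε=2^{1/p}). *)

theory Defs
  imports "HOL-Analysis.Analysis"
begin

text \<open>
  A finite-dimensional complex Hilbert space is taken in coordinates, as \<open>complex^'n\<close> with
  its standard Hermitian inner product, so that the linear operators on it are the matrices of
  type \<open>complex^'n^'n\<close>.
\<close>

type_synonym 'n op = "complex^'n^'n"

definition adj :: "'n::finite op \<Rightarrow> 'n op" where
  "adj A = map_matrix cnj (transpose A)"

definition hermitian :: "'n::finite op \<Rightarrow> bool" where
  "hermitian A \<longleftrightarrow> adj A = A"

definition unitary :: "'n::finite op \<Rightarrow> bool" where
  "unitary U \<longleftrightarrow> adj U ** U = mat 1 \<and> U ** adj U = mat 1"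

text \<open>
  The library inner product \<open>v \<bullet> w\<close> on \<open>complex^'n\<close> is the real part of the Hermitian inner
  product; for Hermitian \<open>A\<close> the number \<open>\<langle>v, A v\<rangle>\<close> is real, so nothing is lost here.
\<close>

definition positive_op :: "'n::finite op \<Rightarrow> bool" where
  "positive_op A \<longleftrightarrow> hermitian A \<and> (\<forall>v. 0 \<le> v \<bullet> (A *v v))"

definition states :: "'n::finite op set" where
  "states = {\<rho>. hermitian \<rho> \<and> positive_op \<rho> \<and> trace \<rho> = 1}"

definition real_diag :: "real^'n \<Rightarrow> 'n::finite op" where
  "real_diag d = (\<chi> i j. if i = j then complex_of_real (d $ i) else 0)"

text \<open>
  Functional calculus \<open>f(A)\<close> of a Hermitian \<open>A\<close>: apply \<open>f\<close> to the eigenvalues in a unitary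
  diagonalisation.  The result does not depend on the diagonalisation; the value for
  non-Hermitian \<open>A\<close> is irrelevant.
\<close>

definition fun_calc :: "(real \<Rightarrow> real) \<Rightarrow> 'n::finite op \<Rightarrow> 'n op" where
  "fun_calc f A = (THE B. \<exists>U d. unitary U \<and> A = U ** real_diag d ** adj U \<and>
                               B = U ** real_diag (\<chi> i. f (d $ i)) ** adj U)"

definition op_abs :: "'n::finite op \<Rightarrow> 'n op" where
  "op_abs A = fun_calc sqrt (adj A ** A)"

text \<open>The trace below is a nonnegative real number, so that \<open>Re\<close> only changes its type.\<close>

definition schatten_norm :: "real \<Rightarrow> 'n::finite op \<Rightarrow> real" where
  "schatten_norm p A = Re (trace (fun_calc (\<lambda>s. s powr p) (op_abs A))) powr (1 / p)"

text \<open>The operator \<open>x |x|\<^sup>p\<^sup>-\<^sup>2\<close> for Hermitian \<open>x\<close>.\<close>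

definition signed_power :: "real \<Rightarrow> 'n::finite op \<Rightarrow> 'n op" where
  "signed_power p A = fun_calc (\<lambda>s. sgn s * \<bar>s\<bar> powr (p - 1)) A"

definition state_ball :: "real \<Rightarrow> 'n::finite op \<Rightarrow> real \<Rightarrow> 'n op set" where
  "state_ball p \<sigma> \<epsilon> = {\<eta> \<in> states. schatten_norm p (\<sigma> - \<eta>) < \<epsilon>}"

definition state_sphere :: "real \<Rightarrow> 'n::finite op \<Rightarrow> real \<Rightarrow> 'n op set" where
  "state_sphere p \<sigma> \<epsilon> = {\<eta> \<in> states. schatten_norm p (\<sigma> - \<eta>) = \<epsilon>}"

definition lindbladian :: "('n::finite op \<Rightarrow> 'n op) \<Rightarrow> bool" where
  "lindbladian L \<longleftrightarrow> (\<exists>(H :: 'n op) (n :: nat) (J :: nat \<Rightarrow> 'n op). hermitian H \<and>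
     (\<forall>\<rho>. L \<rho> = map_matrix ((*) (- \<i>)) (H ** \<rho> - \<rho> ** H) +
       (\<Sum>j = 1..n. J j ** \<rho> ** adj (J j)
          - (1/2) *\<^sub>R (adj (J j) ** J j ** \<rho> + \<rho> ** adj (J j) ** J j))))"

text \<open>
  Weak solutions of \<open>dT/dt = L\<^sub>t T\<^sub>t\<close>, \<open>T\<^sub>0 = id\<close>, are meant in the Caratheodory sense: the
  right-hand side is Lebesgue integrable on bounded intervals and \<open>T\<close> is its primitive.  No
  regularity of \<open>t \<mapsto> L\<^sub>t\<close> alone is required.
\<close>

definition weak_solution ::
    "(real \<Rightarrow> 'n::finite op \<Rightarrow> 'n op) \<Rightarrow> (real \<Rightarrow> 'n op \<Rightarrow> 'n op) \<Rightarrow> bool" where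
  "weak_solution L T \<longleftrightarrow> T 0 = id \<and>
     (\<forall>\<rho>. \<forall>t\<ge>0. (\<lambda>s. L s (T s \<rho>)) absolutely_integrable_on {0..t} \<and>
                 T t \<rho> = \<rho> + integral {0..t} (\<lambda>s. L s (T s \<rho>)))"

definition admissible ::
    "('n::finite op \<Rightarrow> 'n op) set \<Rightarrow> (real \<Rightarrow> 'n op \<Rightarrow> 'n op) \<Rightarrow> bool" where
  "admissible K T \<longleftrightarrow> (\<exists>L. (\<forall>t\<ge>0. L t \<in> K) \<and> weak_solution L T)"

definition reaches :: "('n::finite op \<Rightarrow> 'n op) set \<Rightarrow> 'n op \<Rightarrow> bool" where
  "reaches K \<sigma> \<longleftrightarrow>
     (\<forall>\<rho>\<in>states. \<exists>T. admissible K T \<and> ((\<lambda>t. T t \<rho>) \<longlongrightarrow> \<sigma>) at_top)"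

text \<open>
  Proper containment of a ball in the set of states is used below in the form
  \<open>closure (state_ball p \<sigma> \<epsilon>) \<subset> states\<close>, i.e. some state has distance strictly greater than
  \<open>\<epsilon>\<close> from \<open>\<sigma>\<close>.  The form \<open>state_ball p \<sigma> \<epsilon> \<subset> states\<close> differs from it only if \<open>\<epsilon>\<close> is the
  maximal distance of a state from \<open>\<sigma>\<close>, and admitting that value makes the non-reachability
  theorem false.  For a qubit, \<open>\<sigma> = |0><0|\<close> and \<open>\<epsilon> = 2 powr (1/p)\<close>, the sphere is
  \<open>{|1><1|}\<close>.  With \<open>b\<^sub>\<theta> = -sin \<theta> |0> + cos \<theta> |1>\<close>, the Lindbladians with \<open>H = 0\<close> and the single
  jump operator \<open>|1><b\<^sub>\<theta>|\<close>, for \<open>0 < \<theta> < pi/2\<close>, satisfy the trace condition there with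
  equality; each drives every state to \<open>cos \<theta> |0> + sin \<theta> |1>\<close>, and switching through
  \<open>\<theta> \<rightarrow> 0\<close> reaches \<open>\<sigma>\<close>.
\<close>

end

theory Submission
  imports Defs
begin

text \<open>
  Consider the states \<open>\<eta>\<close> with \<open>\<parallel>\<eta> - \<sigma>\<parallel>\<^sub>p > \<epsilon>\<close>.  For a single \<open>L\<close> in \<open>K\<close> this open exterior is invariant
  under \<open>exp (t L)\<close>: the convex function \<open>tr \<bar>\<eta> - \<sigma>\<bar>\<^sup>p\<close> has gradient \<open>p (\<eta> - \<sigma>) \<bar>\<eta> - \<sigma>\<bar>\<^sup>p\<^sup>-\<^sup>2\<close>, and
  comparing \<open>\<eta>\<close> with its radial retraction onto the sphere shows that the excess over \<open>\<epsilon>\<^sup>p\<close> decreases at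
  most exponentially.  The rates are not uniform over \<open>K\<close>, and \<open>t \<mapsto> \<parallel>L\<^sub>t\<parallel>\<close> need not be integrable, so
  this does not apply to a time-dependent evolution directly.  But positive trace-preserving maps contract
  the trace norm; hence along any weak solution the trace-norm distance to the exterior does not increase
  to first order, whatever the size of \<open>L\<^sub>t\<close>, and the Henstock lemma sums these increments.  A solution
  starting in the exterior therefore stays in its closure, which does not contain \<open>\<sigma>\<close>.
\<close>

section \<open>The spectral theorem\<close>

lemma adj_nth [simp]: "adj A $ i $ j = cnj (A $ j $ i)"
  by (simp add: adj_def transpose_def)

lemma adj_adj [simp]: "adj (adj A) = A"
  by (simp add: vec_eq_iff)

lemma adj_add: "adj (A + B) = adj A + adj B"
  and adj_diff: "adj (A - B) = adj A - adj B"
  and adj_scaleR: "adj (r *\<^sub>R A) = r *\<^sub>R adj A"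
  and adj_zero [simp]: "adj 0 = 0"
  and adj_mat_1 [simp]: "adj (mat 1) = mat 1"
  by (auto simp: vec_eq_iff mat_def)

lemma adj_mult: "adj (A ** B) = adj B ** adj A"
  by (simp add: vec_eq_iff matrix_matrix_mult_def cnj_sum mult.commute)

lemma bounded_linear_adj: "bounded_linear adj"
  by (simp add: linear_conv_bounded_linear[symmetric] linear_iff adj_add adj_scaleR)

lemma adj_sum: "adj (sum f S) = (\<Sum>x\<in>S. adj (f x))"
  by (rule linear_sum) (simp add: linear_iff adj_add adj_scaleR)

lemma matrix_diff_ldistrib: "A ** (B - C) = A ** B - A ** (C :: 'a::ring_1^'n^'m)"
  by (simp add: vec_eq_iff matrix_matrix_mult_def sum_subtractf right_diff_distrib)

lemma matrix_diff_rdistrib: "(A - B) ** C = A ** C - B ** (C :: 'a::ring_1^'n^'m)"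
  by (simp add: vec_eq_iff matrix_matrix_mult_def sum_subtractf left_diff_distrib)

lemma matrix_add_rdistrib: "(A + B) ** C = A ** C + B ** (C :: 'a::semiring_1^'n^'m)"
  by (simp add: vec_eq_iff matrix_matrix_mult_def sum.distrib distrib_right)

lemmas matrix_scaleR_left = scalar_matrix_assoc[symmetric]

lemma matrix_scaleR_right: "A ** (r *\<^sub>R B) = r *\<^sub>R (A ** (B :: 'a::real_algebra_1^'n^'m))"
  by (simp add: vec_eq_iff matrix_matrix_mult_def scaleR_sum_right)

lemma matrix_sum_left: "(\<Sum>x\<in>S. f x) ** B = (\<Sum>x\<in>S. f x ** (B :: 'a::real_algebra_1^'n^'m))"
  by (rule linear_sum[of "\<lambda>A. A ** B"]) (simp add: linear_iff matrix_add_rdistrib matrix_scaleR_left)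

lemma matrix_sum_right: "A ** (\<Sum>x\<in>S. f x) = (\<Sum>x\<in>S. A ** (f x :: 'a::real_algebra_1^'n^'m))"
  by (rule linear_sum[of "\<lambda>B. A ** B"]) (simp add: linear_iff matrix_add_ldistrib matrix_scaleR_right)

lemma inner_matrix: "A \<bullet> B = Re (trace (adj A ** B))" for A B :: "'n::finite op"
proof -
  have "A \<bullet> B = (\<Sum>i\<in>UNIV. \<Sum>j\<in>UNIV. Re (cnj (A $ i $ j) * B $ i $ j))"
    by (simp add: inner_vec_def inner_complex_def)
  also have "\<dots> = (\<Sum>j\<in>UNIV. \<Sum>i\<in>UNIV. Re (cnj (A $ i $ j) * B $ i $ j))"
    by (rule sum.swap)
  finally show ?thesis
    by (simp add: trace_def matrix_matrix_mult_def Re_sum)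
qed

lemma inner_matrix_vector: "v \<bullet> (A *v w) = (adj A *v v) \<bullet> w" for A :: "'n::finite op"
proof -
  have "v \<bullet> (A *v w) = (\<Sum>i\<in>UNIV. \<Sum>j\<in>UNIV. v $ i \<bullet> (A $ i $ j * w $ j))"
    by (simp add: inner_vec_def matrix_vector_mult_def inner_sum_right)
  also have "\<dots> = (\<Sum>j\<in>UNIV. \<Sum>i\<in>UNIV. v $ i \<bullet> (A $ i $ j * w $ j))"
    by (rule sum.swap)
  also have "\<dots> = (adj A *v v) \<bullet> w"
    unfolding inner_vec_def matrix_vector_mult_def vec_lambda_beta inner_sum_left
    by (intro sum.cong refl) (simp add: inner_complex_def algebra_simps)
  finally show ?thesis .
qed

text \<open>The complex structure of the space. As \<open>\<bullet>\<close> is only the real part of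
  the Hermitian product, complex orthogonality of u and v means \<open>u \<bullet> v = 0\<close>
  together with \<open>imult u \<bullet> v = 0\<close>.\<close>

definition imult :: "complex^'n \<Rightarrow> complex^'n::finite" where
  "imult v = (\<chi> k. \<i> * v $ k)"

lemma imult_nth [simp]: "imult v $ k = \<i> * v $ k"
  by (simp add: imult_def)

lemma imult_scaleR: "imult (r *\<^sub>R v) = r *\<^sub>R imult v"
  by (simp add: vec_eq_iff)

lemma imult_inner: "imult v \<bullet> w = - (v \<bullet> imult w)"
  by (simp add: inner_vec_def inner_complex_def sum_negf[symmetric] algebra_simps del: sum_negf)

lemma matrix_imult: "A *v imult v = imult (A *v v)"
  by (simp add: vec_eq_iff matrix_vector_mult_def sum_distrib_left algebra_simps)

lemma hermitian_inner_matrix_vector: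
  "hermitian A \<Longrightarrow> v \<bullet> (A *v w) = (A *v v) \<bullet> w"
  by (simp add: inner_matrix_vector hermitian_def)

lemma matrix_vector_scaleR: "A *v (r *\<^sub>R v) = r *\<^sub>R (A *v (v :: 'a::real_algebra_1^'n))"
  by (simp add: vec_eq_iff matrix_vector_mult_def scaleR_sum_right)

text \<open>Vanishing of the first variation of the Rayleigh quotient at its maximum on \<open>W\<close>.\<close>

lemma hermitian_eigenvector_in_subspace:
  fixes A :: "'n::finite op"
  assumes A: "hermitian A" and W: "subspace W" "closed W" and inv: "\<And>w. w \<in> W \<Longrightarrow> A *v w \<in> W"
    and ne: "w0 \<in> W" "w0 \<noteq> 0"
  obtains v l where "v \<in> W" "norm v = 1" "A *v v = l *\<^sub>R v"
proof -
  let ?S = "W \<inter> sphere 0 1"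
  have comp: "compact ?S" using W(2) by (simp add: closed_Int_compact)
  have "(1 / norm w0) *\<^sub>R w0 \<in> ?S"
    using ne W(1) by (simp add: subspace_scale)
  then have "?S \<noteq> {}" by blast
  moreover have "continuous_on ?S (\<lambda>v. v \<bullet> (A *v v))"
    by (intro continuous_intros linear_continuous_on) (simp add: linear_conv_bounded_linear[symmetric])
  ultimately obtain v where v: "v \<in> ?S" and max: "\<And>w. w \<in> ?S \<Longrightarrow> w \<bullet> (A *v w) \<le> v \<bullet> (A *v v)"
    using continuous_attains_sup[OF comp] by blast
  define l where "l = v \<bullet> (A *v v)"
  have vv: "v \<bullet> v = 1" "v \<in> W" "norm v = 1" using v by (auto simp: dot_square_norm)
  have q: "w \<bullet> (A *v w) \<le> l * (w \<bullet> w)" if "w \<in> W" for w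
  proof (cases "w = 0")
    case False
    then have "(1 / norm w) *\<^sub>R w \<in> ?S" using that W(1) by (simp add: subspace_scale)
    from max[OF this] have "(w \<bullet> (A *v w)) / (norm w)^2 \<le> l"
      by (simp add: l_def matrix_vector_scaleR power2_eq_square)
    then show ?thesis using False by (simp add: dot_square_norm divide_simps)
  qed simp
  \<comment> \<open>Up to a factor 2 this is the gradient at \<open>v\<close> of the form
    \<open>l * (u \<bullet> u) - u \<bullet> (A *v u)\<close> in u, which is nonnegative on
    \<open>W\<close> and vanishes at \<open>v\<close>.\<close>
  define w where "w = l *\<^sub>R v - A *v v"
  have wW: "w \<in> W" unfolding w_def
    using vv W(1) inv by (intro subspace_diff subspace_scale) auto
  define a where "a = l * (w \<bullet> w) - w \<bullet> (A *v w)"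
  have ww: "w \<bullet> w = 0"
  proof (rule ccontr)
    assume "w \<bullet> w \<noteq> 0"
    then have pos: "w \<bullet> w > 0" by simp
    have *: "0 \<le> t\<^sup>2 * a + 2 * t * (w \<bullet> w)" for t
    proof -
      have "v + t *\<^sub>R w \<in> W" using vv wW W(1) by (simp add: subspace_add subspace_scale)
      from q[OF this] have "0 \<le> l * ((v + t *\<^sub>R w) \<bullet> (v + t *\<^sub>R w)) - (v + t *\<^sub>R w) \<bullet> (A *v (v + t *\<^sub>R w))"
        by simp
      also have "\<dots> = t\<^sup>2 * a + 2 * t * (l * (v \<bullet> w) - (A *v v) \<bullet> w) + (l * (v \<bullet> v) - v \<bullet> (A *v v))"
        using hermitian_inner_matrix_vector[OF A, of v w]
        by (simp add: a_def inner_add_left inner_add_right matrix_vector_right_distrib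
            matrix_vector_scaleR algebra_simps power2_eq_square inner_commute)
      also have "\<dots> = t\<^sup>2 * a + 2 * t * (w \<bullet> w)"
        using vv by (simp add: l_def[symmetric]) (simp add: w_def inner_diff_left inner_diff_right algebra_simps)
      finally show ?thesis .
    qed
    have a: "a \<ge> 0" using q[OF wW] by (simp add: a_def)
    \<comment> \<open>A step against the gradient makes the form negative; \<open>a + 1\<close> in
      place of \<open>a\<close> keeps the denominator positive when \<open>a = 0\<close>.\<close>
    let ?t = "- (w \<bullet> w) / (a + 1)"
    have "?t\<^sup>2 * a + 2 * ?t * (w \<bullet> w) = ((w \<bullet> w) / (a + 1))\<^sup>2 * (a - 2 * (a + 1))"
      using a by (simp add: power2_eq_square divide_simps) (simp add: algebra_simps)
    also have "\<dots> < 0" using a pos by (intro mult_pos_neg) auto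
    finally show False using *[of ?t] by simp
  qed
  then have "A *v v = l *\<^sub>R v" by (simp add: w_def)
  with vv that show thesis by blast
qed

text \<open>Induction on the index set: the vectors orthogonal to all \<open>u i\<close> and
  \<open>imult (u i)\<close> form an \<open>A\<close>-invariant subspace, nonzero by counting real
  dimensions, which therefore contains one more eigenvector.\<close>

lemma hermitian_orthonormal_eigenvectors:
  fixes A :: "'n::finite op" and S :: "'n set"
  assumes A: "hermitian A" and "finite S"
  shows "\<exists>u l. (\<forall>i\<in>S. A *v u i = l i *\<^sub>R u i) \<and>
    (\<forall>i\<in>S. \<forall>j\<in>S. u i \<bullet> u j = (if i = j then 1 else 0) \<and> imult (u i) \<bullet> u j = 0)"
  using \<open>finite S\<close>
proof (induction S rule: finite_induct)
  case (insert k S)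
  then obtain u l where ev: "\<And>i. i \<in> S \<Longrightarrow> A *v u i = l i *\<^sub>R u i"
    and on: "\<And>i j. i \<in> S \<Longrightarrow> j \<in> S \<Longrightarrow> u i \<bullet> u j = (if i = j then 1 else 0)"
    and im: "\<And>i j. i \<in> S \<Longrightarrow> j \<in> S \<Longrightarrow> imult (u i) \<bullet> u j = 0"
    by blast
  define B where "B = u ` S \<union> (imult \<circ> u) ` S"
  define W where "W = {w. \<forall>b\<in>B. b \<bullet> w = 0}"
  have "card B \<le> card S + card S"
    unfolding B_def using insert(1)
    by (meson add_mono card_Un_le card_image_le order_trans)
  also have "\<dots> < 2 * CARD('n)"
    using insert by (metis card_insert_disjoint card_mono finite lessI less_le_trans mult_2 subset_UNIV add_less_mono)
  also have "\<dots> = DIM(complex^'n)" by simp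
  finally have "dim (span B) < DIM(complex^'n)"
    by (metis B_def dim_le_card' dim_span finite_UnI finite_imageI insert(1) order_le_less_trans)
  then obtain w0 where w0: "w0 \<noteq> 0" "\<And>b. b \<in> span B \<Longrightarrow> orthogonal w0 b"
    using orthogonal_to_subspace_exists[of B] by (auto simp: dim_span)
  have "w0 \<in> W" using w0(2) by (auto simp: W_def orthogonal_def span_base inner_commute)
  moreover have "subspace W"
    by (auto simp: W_def subspace_def inner_add_right)
  moreover have "closed W" using \<open>subspace W\<close> by (rule closed_subspace)
  moreover have "A *v w \<in> W" if "w \<in> W" for w
  proof -
    have "b \<bullet> (A *v w) = 0" if "b \<in> B" for b
    proof -
      \<comment> \<open>The eigenvalues are real and \<open>A\<close> commutes with
        \<open>imult\<close>, so both kinds of vectors in \<open>B\<close> are eigenvectors; a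
        Hermitian \<open>A\<close> then preserves their orthogonal complement.\<close>
      have "\<exists>r. A *v b = r *\<^sub>R b"
        using that ev by (fastforce simp: B_def matrix_imult imult_scaleR)
      then show ?thesis
        using \<open>w \<in> W\<close> that by (auto simp: hermitian_inner_matrix_vector[OF A] W_def)
    qed
    then show ?thesis by (simp add: W_def)
  qed
  ultimately obtain v r where v: "v \<in> W" "norm v = 1" "A *v v = r *\<^sub>R v"
    using hermitian_eigenvector_in_subspace[OF A _ _ _ _ w0(1)] by metis
  have vo: "u i \<bullet> v = 0" "imult (u i) \<bullet> v = 0" "v \<bullet> u i = 0" "imult v \<bullet> u i = 0" if "i \<in> S" for i
    using that v(1) imult_inner[of v "u i"] by (auto simp: W_def B_def inner_commute)
  have v1: "v \<bullet> v = 1" "imult v \<bullet> v = 0"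
    using v(2) imult_inner[of v v] by (auto simp: dot_square_norm inner_commute)
  show ?case
  proof (intro exI conjI ballI)
    fix i assume "i \<in> insert k S"
    then show "A *v (u(k := v)) i = (l(k := r)) i *\<^sub>R (u(k := v)) i"
      using ev v insert(2) by auto
    fix j assume "j \<in> insert k S"
    with \<open>i \<in> insert k S\<close>
    show "(u(k := v)) i \<bullet> (u(k := v)) j = (if i = j then 1 else 0)"
      "imult ((u(k := v)) i) \<bullet> (u(k := v)) j = 0"
      using on im vo v1 insert(2) by auto
  qed
qed simp

theorem hermitian_diagonalisation:
  fixes A :: "'n::finite op"
  assumes "hermitian A"
  obtains U d where "unitary U" "A = U ** real_diag d ** adj U"
proof -
  obtain u :: "'n \<Rightarrow> complex^'n" and l :: "'n \<Rightarrow> real" where ev: "\<And>i. A *v u i = l i *\<^sub>R u i"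
    and on: "\<And>i j. u i \<bullet> u j = (if i = j then 1 else 0)" and im: "\<And>i j. imult (u i) \<bullet> u j = 0"
    using hermitian_orthonormal_eigenvectors[OF assms finite, of UNIV] by auto
  define U :: "'n op" where "U = (\<chi> k i. u i $ k)"
  \<comment> \<open>The two families of real orthogonality relations are the real and imaginary
    parts of unitarity.\<close>
  have "(adj U ** U) $ i $ j = Complex (u i \<bullet> u j) (imult (u i) \<bullet> u j)" for i j
    by (simp add: U_def matrix_matrix_mult_def complex_eq_iff inner_vec_def inner_complex_def Re_sum Im_sum
        sum.distrib sum_subtractf sum_negf algebra_simps)
  then have 1: "adj U ** U = mat 1"
    by (simp add: vec_eq_iff on im mat_def complex_eq_iff)
  then have 2: "U ** adj U = mat 1"
    using matrix_left_right_inverse by blast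
  have "A ** U = U ** real_diag (\<chi> i. l i)"
  proof -
    have "(A ** U) $ k $ i = (A *v u i) $ k" for k i
      by (simp add: U_def matrix_matrix_mult_def matrix_vector_mult_def)
    moreover have "(U ** real_diag (\<chi> i. l i)) $ k $ i = (l i *\<^sub>R u i) $ k" for k i
      by (simp add: U_def matrix_matrix_mult_def real_diag_def if_distrib[of "\<lambda>x. _ * x"]
          cong: if_cong) (simp add: scaleR_conv_of_real mult.commute)
    ultimately show ?thesis by (simp add: vec_eq_iff ev)
  qed
  then have "A = U ** real_diag (\<chi> i. l i) ** adj U"
    by (metis 2 matrix_mul_assoc matrix_mul_rid)
  with 1 2 that show thesis unfolding unitary_def by blast
qed


section \<open>Functional calculus and Klein's inequality\<close>

definition spectral_op :: "'n::finite op \<Rightarrow> real^'n \<Rightarrow> 'n op" where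
  "spectral_op U d = U ** real_diag d ** adj U"

lemma hermitian_spectral_cases:
  assumes "hermitian A"
  obtains U d where "unitary U" "A = spectral_op U d"
  using hermitian_diagonalisation[OF assms] unfolding spectral_op_def by metis

lemma real_diag_mult: "(A ** real_diag d) $ i $ j = A $ i $ j * of_real (d $ j)"
  by (simp add: matrix_matrix_mult_def real_diag_def if_distrib[of "\<lambda>x. _ * x"] cong: if_cong)

lemma mult_real_diag: "(real_diag d ** A) $ i $ j = of_real (d $ i) * A $ i $ j"
  by (simp add: matrix_matrix_mult_def real_diag_def if_distrib[of "\<lambda>x. x * _"] cong: if_cong)

lemma real_diag_vector: "(real_diag d *v v) $ i = d $ i *\<^sub>R v $ i"
  by (simp add: matrix_vector_mult_def real_diag_def if_distrib[of "\<lambda>x. x * _"] cong: if_cong)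
    (simp add: scaleR_conv_of_real)

lemma adj_real_diag [simp]: "adj (real_diag d) = real_diag d"
  by (simp add: vec_eq_iff real_diag_def)

lemma hermitian_spectral_op [simp]: "hermitian (spectral_op U d)"
  by (simp add: hermitian_def spectral_op_def adj_mult matrix_mul_assoc)

lemma unitary_cancel:
  assumes "unitary U"
  shows "A ** U ** adj U = A" "A ** adj U ** U = A"
  using assms unfolding unitary_def by (metis matrix_mul_assoc matrix_mul_rid)+

lemma unitary_adj_mult:
  assumes "unitary U" "unitary V"
  shows "unitary (adj U ** V)"
  using assms unitary_cancel[OF assms(1), of "adj V"] unitary_cancel[OF assms(2), of "adj U"]
  by (simp add: unitary_def adj_mult matrix_mul_assoc)

text \<open>Independence of the diagonalisation: for two of them, \<open>W = adj V ** U\<close>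
  intertwines the diagonal matrices, so a nonzero entry \<open>W $ i $ j\<close> forces
  \<open>d $ j = e $ i\<close>. Hence \<open>W\<close> also intertwines the images under
  \<open>f\<close>.\<close>

lemma fun_calc_spectral_op:
  assumes U: "unitary U"
  shows "fun_calc f (spectral_op U d) = spectral_op U (\<chi> i. f (d $ i))"
  unfolding fun_calc_def
proof (rule the_equality)
  show "\<exists>V e. unitary V \<and> spectral_op U d = V ** real_diag e ** adj V \<and>
      spectral_op U (\<chi> i. f (d $ i)) = V ** real_diag (\<chi> i. f (e $ i)) ** adj V"
    using U by (auto simp: spectral_op_def)
next
  fix B assume "\<exists>V e. unitary V \<and> spectral_op U d = V ** real_diag e ** adj V \<and>
      B = V ** real_diag (\<chi> i. f (e $ i)) ** adj V"
  then obtain V e where V: "unitary V" and eq: "spectral_op U d = V ** real_diag e ** adj V"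
    and B: "B = V ** real_diag (\<chi> i. f (e $ i)) ** adj V" by blast
  define W where "W = adj V ** U"
  have "adj V ** spectral_op U d ** U = W ** real_diag d"
    unfolding W_def spectral_op_def by (simp add: matrix_mul_assoc unitary_cancel[OF U])
  moreover have "adj V ** spectral_op U d ** U = real_diag e ** W"
    using V unfolding W_def eq by (simp add: matrix_mul_assoc unitary_def)
  ultimately have "W ** real_diag d = real_diag e ** W" by simp
  then have "W $ i $ j * of_real (d $ j) = of_real (e $ i) * W $ i $ j" for i j
    by (metis real_diag_mult mult_real_diag)
  then have *: "W $ i $ j = 0 \<or> d $ j = e $ i" for i j
    by (metis mult.commute mult_left_cancel of_real_eq_iff)
  have "W $ i $ j * of_real (f (d $ j)) = of_real (f (e $ i)) * W $ i $ j" for i j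
    using *[of i j] by auto
  then have "W ** real_diag (\<chi> i. f (d $ i)) = real_diag (\<chi> i. f (e $ i)) ** W"
    by (simp add: vec_eq_iff real_diag_mult mult_real_diag)
  then have "V ** (W ** real_diag (\<chi> i. f (d $ i))) ** adj U = V ** (real_diag (\<chi> i. f (e $ i)) ** W) ** adj U"
    by simp
  then show "B = spectral_op U (\<chi> i. f (d $ i))"
    using V unfolding B W_def spectral_op_def
    by (simp add: matrix_mul_assoc unitary_cancel[OF U] unitary_def)
qed

lemma trace_spectral_op:
  assumes "unitary U"
  shows "trace (spectral_op U d) = of_real (\<Sum>i\<in>UNIV. d $ i)"
proof -
  have "trace (spectral_op U d) = trace (adj U ** U ** real_diag d)"
    unfolding spectral_op_def by (metis matrix_mul_assoc trace_mul_sym)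
  also have "\<dots> = trace (real_diag d)" using assms by (simp add: unitary_def)
  finally show ?thesis by (simp add: trace_def real_diag_def)
qed

lemma spectral_op_mult:
  assumes "unitary U"
  shows "spectral_op U d ** spectral_op U e = spectral_op U (\<chi> i. d $ i * e $ i)"
proof -
  have "spectral_op U d ** spectral_op U e = U ** (real_diag d ** real_diag e) ** adj U"
    unfolding spectral_op_def by (simp add: matrix_mul_assoc unitary_cancel[OF assms])
  also have "real_diag d ** real_diag e = real_diag (\<chi> i. d $ i * e $ i)"
    by (simp add: vec_eq_iff real_diag_mult) (simp add: real_diag_def)
  finally show ?thesis by (simp add: spectral_op_def)
qed

lemma scaleR_spectral_op: "r *\<^sub>R spectral_op U d = spectral_op U (r *\<^sub>R d)"
proof -
  have "real_diag (r *\<^sub>R d) = r *\<^sub>R real_diag d"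
    by (simp add: vec_eq_iff real_diag_def) (simp add: scaleR_conv_of_real)
  then show ?thesis by (simp add: spectral_op_def matrix_scaleR_left matrix_scaleR_right)
qed

lemma uminus_spectral_op: "- spectral_op U d = spectral_op U (- d)"
  using scaleR_spectral_op[of "-1" U d] by simp

lemma spectral_op_diff: "spectral_op U d - spectral_op U e = spectral_op U (d - e)"
proof -
  have "real_diag (d - e) = real_diag d - real_diag e"
    by (auto simp: vec_eq_iff real_diag_def)
  then show ?thesis by (simp add: spectral_op_def matrix_diff_ldistrib matrix_diff_rdistrib)
qed

lemma unitary_row_sums:
  assumes "unitary W"
  shows "(\<Sum>j\<in>UNIV. (cmod (W $ i $ j))\<^sup>2) = 1" "(\<Sum>i\<in>UNIV. (cmod (W $ i $ j))\<^sup>2) = 1"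
proof -
  have "(W ** adj W) $ i $ i = 1" "(adj W ** W) $ j $ j = 1"
    using assms by (simp_all add: unitary_def mat_def)
  then have "of_real (\<Sum>j\<in>UNIV. (cmod (W $ i $ j))\<^sup>2) = (1::complex)"
    "of_real (\<Sum>i\<in>UNIV. (cmod (W $ i $ j))\<^sup>2) = (1::complex)"
    by (simp_all add: matrix_matrix_mult_def complex_norm_square mult.commute del: of_real_power)
  then show "(\<Sum>j\<in>UNIV. (cmod (W $ i $ j))\<^sup>2) = 1" "(\<Sum>i\<in>UNIV. (cmod (W $ i $ j))\<^sup>2) = 1"
    by (simp_all only: of_real_eq_1_iff)
qed

text \<open>Evaluating the trace in the two eigenbases leaves the squared overlaps as weights; for
  unitary \<open>U\<close> and \<open>V\<close> these form a doubly stochastic matrix by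
  \<open>unitary_row_sums\<close>.\<close>

lemma inner_spectral_op:
  "spectral_op U a \<bullet> spectral_op V b =
    (\<Sum>i\<in>UNIV. \<Sum>j\<in>UNIV. (cmod ((adj U ** V) $ i $ j))\<^sup>2 * (a $ i * b $ j))"
proof -
  define W where "W = adj U ** V"
  have "spectral_op U a \<bullet> spectral_op V b = Re (trace (spectral_op U a ** spectral_op V b))"
    using hermitian_spectral_op[of U a] by (simp add: inner_matrix hermitian_def)
  also have "spectral_op U a ** spectral_op V b = U ** (real_diag a ** W ** real_diag b ** adj V)"
    by (simp add: spectral_op_def W_def matrix_mul_assoc)
  also have "trace \<dots> = trace ((real_diag a ** W ** real_diag b) ** adj W)"
    by (subst trace_mul_sym) (simp add: W_def adj_mult matrix_mul_assoc)
  also have "\<dots> = (\<Sum>i\<in>UNIV. \<Sum>j\<in>UNIV. of_real ((cmod (W $ i $ j))\<^sup>2 * (a $ i * b $ j)))"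
    unfolding trace_def matrix_matrix_mult_def[of _ "adj W"] vec_lambda_beta
    by (intro sum.cong refl) (simp add: real_diag_mult mult_real_diag complex_norm_square del: of_real_power)
  finally show ?thesis by (simp add: W_def)
qed

lemma inner_spectral_op_same:
  assumes "unitary U"
  shows "spectral_op U a \<bullet> spectral_op U b = a \<bullet> b"
proof -
  have "spectral_op U a \<bullet> spectral_op U b = (\<Sum>i\<in>UNIV. \<Sum>j\<in>UNIV. (if i = j then a $ i * b $ j else 0))"
    unfolding inner_spectral_op using assms
    by (intro sum.cong refl) (simp add: unitary_def mat_def)
  then show ?thesis by (simp add: inner_vec_def)
qed

lemma norm_spectral_op: "unitary U \<Longrightarrow> norm (spectral_op U a) = norm a"
  by (simp add: norm_eq_sqrt_inner inner_spectral_op_same)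

lemma positive_spectral_op_iff:
  assumes "unitary U"
  shows "positive_op (spectral_op U d) \<longleftrightarrow> (\<forall>i. 0 \<le> d $ i)"
proof
  assume pos: "positive_op (spectral_op U d)"
  show "\<forall>i. 0 \<le> d $ i"
  proof
    fix i
    define v :: "complex^'a" where "v = axis i 1"
    have "0 \<le> (U *v v) \<bullet> (spectral_op U d *v (U *v v))"
      using pos by (simp add: positive_op_def)
    also have "\<dots> = v \<bullet> ((adj U ** U) ** real_diag d ** (adj U ** U) *v v)"
      by (simp add: spectral_op_def matrix_vector_mul_assoc inner_matrix_vector adj_mult matrix_mul_assoc)
    also have "\<dots> = v \<bullet> (real_diag d *v v)"
      using assms by (simp add: unitary_def)
    also have "real_diag d *v v = d $ i *\<^sub>R v"
      by (simp add: v_def vec_eq_iff real_diag_vector axis_def)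
    also have "v \<bullet> \<dots> = d $ i"
      by (simp add: v_def dot_square_norm)
    finally show "0 \<le> d $ i" .
  qed
next
  assume d: "\<forall>i. 0 \<le> d $ i"
  have "0 \<le> v \<bullet> (spectral_op U d *v v)" for v
  proof -
    define w where "w = adj U *v v"
    have "v \<bullet> (spectral_op U d *v v) = w \<bullet> (real_diag d *v w)"
      by (simp add: spectral_op_def matrix_vector_mul_assoc[symmetric] inner_matrix_vector w_def)
    also have "\<dots> = (\<Sum>i\<in>UNIV. d $ i * (w $ i \<bullet> w $ i))"
      by (simp add: inner_vec_def real_diag_vector)
    also have "\<dots> \<ge> 0" using d by (intro sum_nonneg mult_nonneg_nonneg) auto
    finally show ?thesis by simp
  qed
  then show "positive_op (spectral_op U d)" by (simp add: positive_op_def)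
qed

lemma op_abs_spectral_op:
  assumes "unitary U"
  shows "op_abs (spectral_op U d) = spectral_op U (\<chi> i. \<bar>d $ i\<bar>)"
proof -
  have "adj (spectral_op U d) ** spectral_op U d = spectral_op U (\<chi> i. (d $ i)\<^sup>2)"
    using hermitian_spectral_op[of U d]
    by (simp add: hermitian_def spectral_op_mult[OF assms] power2_eq_square)
  then show ?thesis by (simp add: op_abs_def fun_calc_spectral_op[OF assms])
qed

text \<open>The p-th power of the Schatten norm. Without the root, the gradient at a Hermitian
  operator is simply p times \<open>signed_power\<close>.\<close>

definition trace_power :: "real \<Rightarrow> 'n::finite op \<Rightarrow> real" where
  "trace_power p A = Re (trace (fun_calc (\<lambda>s. s powr p) (op_abs A)))"

lemma schatten_norm_trace_power: "schatten_norm p A = trace_power p A powr (1 / p)"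
  by (simp add: schatten_norm_def trace_power_def)

lemma trace_power_spectral_op:
  "unitary U \<Longrightarrow> trace_power p (spectral_op U d) = (\<Sum>i\<in>UNIV. \<bar>d $ i\<bar> powr p)"
  by (simp add: trace_power_def op_abs_spectral_op fun_calc_spectral_op trace_spectral_op)

lemma signed_power_spectral_op:
  "unitary U \<Longrightarrow> signed_power p (spectral_op U d) =
    spectral_op U (\<chi> i. sgn (d $ i) * \<bar>d $ i\<bar> powr (p - 1))"
  by (simp add: signed_power_def fun_calc_spectral_op)

lemma trace_power_nonneg: "hermitian A \<Longrightarrow> 0 \<le> trace_power p A"
  by (erule hermitian_spectral_cases) (simp add: trace_power_spectral_op sum_nonneg)

lemma trace_power_uminus: "hermitian A \<Longrightarrow> trace_power p (- A) = trace_power p A"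
  by (erule hermitian_spectral_cases) (simp add: trace_power_spectral_op uminus_spectral_op)

lemma trace_power_scaleR:
  assumes "hermitian A" "0 \<le> r"
  shows "trace_power p (r *\<^sub>R A) = r powr p * trace_power p A"
proof -
  obtain U d where "unitary U" "A = spectral_op U d"
    using hermitian_spectral_cases[OF assms(1)] .
  with assms(2) show ?thesis
    by (simp add: scaleR_spectral_op trace_power_spectral_op abs_mult powr_mult sum_distrib_left)
qed

lemma hermitian_signed_power: "hermitian A \<Longrightarrow> hermitian (signed_power p A)"
  by (erule hermitian_spectral_cases) (simp add: signed_power_spectral_op)

lemma signed_power_scaleR:
  assumes "hermitian A" "0 < r"
  shows "signed_power p (r *\<^sub>R A) = r powr (p - 1) *\<^sub>R signed_power p A"
proof -
  obtain U d where Ud: "unitary U" "A = spectral_op U d"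
    using hermitian_spectral_cases[OF assms(1)] .
  have "(\<chi> i. sgn ((r *\<^sub>R d) $ i) * \<bar>(r *\<^sub>R d) $ i\<bar> powr (p - 1)) =
      r powr (p - 1) *\<^sub>R (\<chi> i. sgn (d $ i) * \<bar>d $ i\<bar> powr (p - 1))"
    using assms(2) by (simp add: vec_eq_iff abs_mult powr_mult sgn_mult)
  with Ud show ?thesis by (simp add: scaleR_spectral_op signed_power_spectral_op)
qed

text \<open>Every eigenvalue is at most the Frobenius norm in modulus. This crude bound later keeps
  the exterior away from \<sigma>.\<close>

lemma trace_power_le_norm:
  fixes A :: "'n::finite op"
  assumes "hermitian A" "0 \<le> p"
  shows "trace_power p A \<le> CARD('n) * norm A powr p"
proof -
  obtain U d where Ud: "unitary U" "A = spectral_op U d"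
    using hermitian_spectral_cases[OF assms(1)] .
  have "\<bar>d $ i\<bar> powr p \<le> norm A powr p" for i
    using Ud assms(2) component_le_norm_cart[of d i] by (intro powr_mono2) (auto simp: norm_spectral_op)
  then have "(\<Sum>i\<in>UNIV. \<bar>d $ i\<bar> powr p) \<le> of_nat (card (UNIV :: 'n set)) * norm A powr p"
    by (intro sum_bounded_above)
  with Ud show ?thesis by (simp add: trace_power_spectral_op)
qed

lemma norm_signed_power_le:
  fixes A :: "'n::finite op"
  assumes "hermitian A" "1 \<le> p"
  shows "norm (signed_power p A) \<le> CARD('n) * norm A powr (p - 1)"
proof -
  obtain U d where Ud: "unitary U" "A = spectral_op U d"
    using hermitian_spectral_cases[OF assms(1)] .
  let ?e = "\<chi> i. sgn (d $ i) * \<bar>d $ i\<bar> powr (p - 1)"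
  have "\<bar>?e $ i\<bar> \<le> norm A powr (p - 1)" for i
  proof -
    have "\<bar>?e $ i\<bar> \<le> \<bar>d $ i\<bar> powr (p - 1)" by (simp add: abs_mult sgn_if)
    also have "\<dots> \<le> norm A powr (p - 1)"
      using Ud assms(2) component_le_norm_cart[of d i] by (intro powr_mono2) (auto simp: norm_spectral_op)
    finally show ?thesis .
  qed
  then have "(\<Sum>i\<in>UNIV. \<bar>?e $ i\<bar>) \<le> of_nat (card (UNIV :: 'n set)) * norm A powr (p - 1)"
    by (intro sum_bounded_above)
  with Ud show ?thesis
    using norm_le_l1_cart[of ?e] by (simp add: signed_power_spectral_op norm_spectral_op)
qed

text \<open>Convexity of the p-th power of the modulus. For \<open>a = 0\<close> the left side is 0;
  otherwise \<open>(b - a) * sgn a \<le> \<bar>b\<bar> - \<bar>a\<bar>\<close> reduces the claim to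
  nonnegative arguments.\<close>

lemma abs_powr_above_tangent:
  fixes a b p :: real
  assumes "1 < p"
  shows "\<bar>a\<bar> powr p + p * ((b - a) * (sgn a * \<bar>a\<bar> powr (p - 1))) \<le> \<bar>b\<bar> powr p"
proof (cases "a = 0")
  case False
  define u where "u = \<bar>a\<bar>"
  define v where "v = \<bar>b\<bar>"
  have u: "u > 0" and v: "v \<ge> 0" using False by (auto simp: u_def v_def)
  have "(b - a) * sgn a \<le> v - u"
    using False by (cases "a > 0") (auto simp: u_def v_def)
  then have "p * ((b - a) * sgn a * u powr (p - 1)) \<le> p * ((v - u) * u powr (p - 1))"
    using assms by (intro mult_left_mono mult_right_mono) auto
  \<comment> \<open>The tangent inequality is taken on the open half line, where the power is
    differentiable; the endpoint \<open>v = 0\<close> is checked directly.\<close>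
  moreover have "u powr p + p * ((v - u) * u powr (p - 1)) \<le> v powr p"
  proof (cases "v = 0")
    case True
    have "u * u powr (p - 1) = u powr p" using u by (simp add: powr_mult_base)
    then show ?thesis using True assms mult_right_mono[of 1 p "u powr p"] by simp
  next
    case False
    with v have "v > 0" by simp
    have "v powr p - u powr p \<ge> p * u powr (p - 1) * (v - u)"
    proof (rule convex_on_imp_above_tangent[of "{0<..}"])
      show "convex_on {0<..} (\<lambda>x. x powr p)" using assms by (intro powr_convex) auto
      show "((\<lambda>x. x powr p) has_real_derivative p * u powr (p - 1)) (at u within {0<..})"
        using u by (auto intro!: derivative_eq_intros)
    qed (use u \<open>v > 0\<close> in \<open>auto simp: interior_open\<close>)
    then show ?thesis by (simp add: algebra_simps)
  qed
  ultimately show ?thesis by (simp add: u_def v_def algebra_simps)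
qed simp

text \<open>Klein's inequality: the doubly stochastic matrix \<open>\<bar>W\<^sub>i\<^sub>j\<bar>\<^sup>2\<close> reduces it to the scalar
  tangent inequality at each pair of eigenvalues.\<close>

lemma trace_power_above_tangent:
  fixes X Y :: "'n::finite op"
  assumes p: "1 < p" and X: "hermitian X" and Y: "hermitian Y"
  shows "trace_power p X + p * ((Y - X) \<bullet> signed_power p X) \<le> trace_power p Y"
proof -
  obtain U a where U: "unitary U" "X = spectral_op U a" using hermitian_spectral_cases[OF X] .
  obtain V b where V: "unitary V" "Y = spectral_op V b" using hermitian_spectral_cases[OF Y] .
  define g where "g = (\<lambda>s :: real. sgn s * \<bar>s\<bar> powr (p - 1))"
  define w where "w = (\<lambda>i j. (cmod ((adj U ** V) $ i $ j))\<^sup>2)"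
  have W: "unitary (adj U ** V)" using U V by (simp add: unitary_adj_mult)
  have row: "(\<Sum>j\<in>UNIV. w i j) = 1" and col: "(\<Sum>i\<in>UNIV. w i j) = 1" for i j
    using unitary_row_sums[OF W] by (simp_all add: w_def)
  have X1: "trace_power p X = (\<Sum>i\<in>UNIV. \<Sum>j\<in>UNIV. w i j * \<bar>a $ i\<bar> powr p)"
    by (simp add: U trace_power_spectral_op sum_distrib_right[symmetric] row)
  have "trace_power p Y = (\<Sum>j\<in>UNIV. \<Sum>i\<in>UNIV. w i j * \<bar>b $ j\<bar> powr p)"
    by (simp add: V trace_power_spectral_op sum_distrib_right[symmetric] col)
  also have "\<dots> = (\<Sum>i\<in>UNIV. \<Sum>j\<in>UNIV. w i j * \<bar>b $ j\<bar> powr p)"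
    by (rule sum.swap)
  finally have Y1: "trace_power p Y = (\<Sum>i\<in>UNIV. \<Sum>j\<in>UNIV. w i j * \<bar>b $ j\<bar> powr p)" .
  have "X \<bullet> signed_power p X = (\<Sum>i\<in>UNIV. a $ i * g (a $ i))"
    by (simp add: U signed_power_spectral_op inner_spectral_op_same g_def) (simp add: inner_vec_def)
  also have "\<dots> = (\<Sum>i\<in>UNIV. \<Sum>j\<in>UNIV. w i j * (a $ i * g (a $ i)))"
    by (simp add: sum_distrib_right[symmetric] row)
  finally have "X \<bullet> signed_power p X = (\<Sum>i\<in>UNIV. \<Sum>j\<in>UNIV. w i j * (a $ i * g (a $ i)))" .
  moreover have "Y \<bullet> signed_power p X = (\<Sum>i\<in>UNIV. \<Sum>j\<in>UNIV. w i j * (b $ j * g (a $ i)))"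
    by (subst inner_commute) (simp add: U V signed_power_spectral_op inner_spectral_op w_def g_def mult_ac)
  ultimately have XY: "(Y - X) \<bullet> signed_power p X
      = (\<Sum>i\<in>UNIV. \<Sum>j\<in>UNIV. w i j * ((b $ j - a $ i) * g (a $ i)))"
    by (simp add: inner_diff_left sum_subtractf[symmetric] algebra_simps)
  have "trace_power p X + p * ((Y - X) \<bullet> signed_power p X)
      = (\<Sum>i\<in>UNIV. \<Sum>j\<in>UNIV. w i j * (\<bar>a $ i\<bar> powr p + p * ((b $ j - a $ i) * g (a $ i))))"
    unfolding X1 XY by (simp add: sum_distrib_left sum.distrib[symmetric] algebra_simps)
  also have "\<dots> \<le> trace_power p Y"
    unfolding Y1 g_def using abs_powr_above_tangent[OF p]
    by (intro sum_mono mult_left_mono) (auto simp: w_def)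
  finally show ?thesis .
qed


section \<open>Euler steps of a Lindbladian by stochastic maps\<close>

lemma Re_trace_inner: "Re (trace A) = mat 1 \<bullet> A" for A :: "'n::finite op"
  by (simp add: inner_matrix)

lemma linear_Re_trace: "linear (\<lambda>A :: 'n::finite op. Re (trace A))"
  by (simp add: Re_trace_inner linear_iff inner_add_right)

lemmas Re_trace_simps =
  linear_add[OF linear_Re_trace] linear_diff[OF linear_Re_trace] linear_scale[OF linear_Re_trace]
  linear_sum[OF linear_Re_trace]

lemma hermitian_add: "hermitian A \<Longrightarrow> hermitian B \<Longrightarrow> hermitian (A + B)"
  and hermitian_diff: "hermitian A \<Longrightarrow> hermitian B \<Longrightarrow> hermitian (A - B)"
  and hermitian_scaleR: "hermitian A \<Longrightarrow> hermitian (r *\<^sub>R A)"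
  and hermitian_zero: "hermitian 0"
  by (simp_all add: hermitian_def adj_add adj_diff adj_scaleR)

lemma hermitian_Im_trace: "hermitian A \<Longrightarrow> Im (trace A) = 0"
  by (erule hermitian_spectral_cases) (simp add: trace_spectral_op)

lemma positive_hermitian: "positive_op A \<Longrightarrow> hermitian A"
  by (simp add: positive_op_def)

lemma positive_zero [simp]: "positive_op 0"
  by (simp add: positive_op_def hermitian_zero)

lemma scaleR_matrix_vector: "(r *\<^sub>R A) *v v = r *\<^sub>R (A *v (v :: 'a::real_algebra_1^'n))"
  by (simp add: vec_eq_iff matrix_vector_mult_def scaleR_sum_right)

lemma positive_add: "positive_op A \<Longrightarrow> positive_op B \<Longrightarrow> positive_op (A + B)"
  by (simp add: positive_op_def hermitian_add matrix_vector_mult_add_rdistrib inner_add_right)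

lemma positive_scaleR: "positive_op A \<Longrightarrow> 0 \<le> r \<Longrightarrow> positive_op (r *\<^sub>R A)"
  by (simp add: positive_op_def hermitian_scaleR scaleR_matrix_vector)

lemma positive_sum: "(\<And>x. x \<in> S \<Longrightarrow> positive_op (f x)) \<Longrightarrow> positive_op (sum f S)"
  by (induction S rule: infinite_finite_induct) (auto intro: positive_add)

lemma positive_conj:
  assumes "positive_op P"
  shows "positive_op (B ** P ** adj B)"
proof -
  have "v \<bullet> (B ** P ** adj B *v v) = (adj B *v v) \<bullet> (P *v (adj B *v v))" for v
    by (simp add: matrix_vector_mul_assoc[symmetric] inner_matrix_vector)
  with assms show ?thesis
    by (simp add: positive_op_def hermitian_def adj_mult matrix_mul_assoc)
qed

text \<open>The Frobenius norm is the l2 norm of the eigenvalues, and the trace is their l1 norm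
  once they are nonnegative.\<close>

lemma norm_le_trace_positive:
  assumes "positive_op P"
  shows "norm P \<le> Re (trace P)"
proof -
  obtain U d where Ud: "unitary U" "P = spectral_op U d"
    using hermitian_spectral_cases[OF positive_hermitian[OF assms]] .
  then have "0 \<le> d $ i" for i using assms by (simp add: positive_spectral_op_iff)
  then show ?thesis
    using Ud norm_le_l1_cart[of d] by (simp add: norm_spectral_op trace_spectral_op)
qed

lemma trace_positive_nonneg: "positive_op P \<Longrightarrow> 0 \<le> Re (trace P)"
  using norm_le_trace_positive norm_ge_zero order_trans by blast

text \<open>The Jordan decomposition: the traces of the spectral positive and negative parts add up
  to the trace norm, a sum of \<open>CARD('n)\<close> terms each bounded by the Frobenius
  norm.\<close>

lemma hermitian_decomposition:
  fixes Y :: "'n::finite op"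
  assumes "hermitian Y"
  obtains P Q where "positive_op P" "positive_op Q" "Y = P - Q"
    "Re (trace P) + Re (trace Q) \<le> CARD('n) * norm Y"
proof -
  obtain U d where Ud: "unitary U" "Y = spectral_op U d"
    using hermitian_spectral_cases[OF assms] .
  let ?P = "spectral_op U (\<chi> i. max 0 (d $ i))"
  let ?Q = "spectral_op U (\<chi> i. max 0 (- d $ i))"
  have "\<bar>d $ i\<bar> \<le> norm Y" for i
    using Ud component_le_norm_cart[of d i] by (simp add: norm_spectral_op)
  then have "(\<Sum>i\<in>UNIV. \<bar>d $ i\<bar>) \<le> of_nat (card (UNIV :: 'n set)) * norm Y"
    by (intro sum_bounded_above)
  moreover have "Re (trace ?P) + Re (trace ?Q) = (\<Sum>i\<in>UNIV. \<bar>d $ i\<bar>)"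
    by (auto simp: trace_spectral_op Ud sum.distrib[symmetric] intro!: sum.cong)
  moreover have "Y = ?P - ?Q"
    unfolding spectral_op_diff Ud by (intro arg_cong[where f = "spectral_op U"]) (auto simp: vec_eq_iff max_def)
  moreover have "positive_op ?P" "positive_op ?Q"
    by (simp_all add: positive_spectral_op_iff Ud)
  ultimately show thesis using that by metis
qed

lemma states_iff: "\<rho> \<in> states \<longleftrightarrow> positive_op \<rho> \<and> Re (trace \<rho>) = 1"
  using hermitian_Im_trace[of \<rho>] by (auto simp: states_def complex_eq_iff positive_op_def)

lemma states_hermitian: "\<rho> \<in> states \<Longrightarrow> hermitian \<rho>"
  by (simp add: states_def)

lemma norm_state_le: "\<rho> \<in> states \<Longrightarrow> norm \<rho> \<le> 1"
  using norm_le_trace_positive by (fastforce simp: states_iff)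

lemma convex_states: "convex states"
  unfolding convex_alt by (auto simp: states_iff positive_add positive_scaleR Re_trace_simps)

text \<open>Linearity, positivity and trace preservation are what trace-norm contraction rests on;
  on Hermitian operators the real part of the trace is the whole trace.\<close>

definition stochastic_map :: "('n::finite op \<Rightarrow> 'n op) \<Rightarrow> bool" where
  "stochastic_map \<Psi> \<longleftrightarrow> linear \<Psi> \<and> (\<forall>P. positive_op P \<longrightarrow> positive_op (\<Psi> P)) \<and>
    (\<forall>x. Re (trace (\<Psi> x)) = Re (trace x))"

lemma stochastic_map_state: "stochastic_map \<Psi> \<Longrightarrow> \<rho> \<in> states \<Longrightarrow> \<Psi> \<rho> \<in> states"
  by (simp add: stochastic_map_def states_iff)

lemma stochastic_map_funpow: "stochastic_map \<Psi> \<Longrightarrow> stochastic_map (\<Psi> ^^ k)"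
  by (induction k) (auto simp: stochastic_map_def o_def linear_iff)

text \<open>Splitting into positive parts turns norms into traces, which are preserved. The constant
  does not depend on the map, so it serves all iterates of a map at once.\<close>

lemma norm_stochastic_map_le:
  fixes y :: "'n::finite op"
  assumes "stochastic_map \<Psi>" "hermitian y"
  shows "norm (\<Psi> y) \<le> CARD('n) * norm y"
proof -
  obtain P Q where PQ: "positive_op P" "positive_op Q" "y = P - Q"
    "Re (trace P) + Re (trace Q) \<le> CARD('n) * norm y"
    using hermitian_decomposition[OF assms(2)] .
  have "norm (\<Psi> y) \<le> norm (\<Psi> P) + norm (\<Psi> Q)"
    using assms(1) PQ(3) by (simp add: stochastic_map_def linear_diff norm_triangle_ineq4)
  also have "\<dots> \<le> Re (trace (\<Psi> P)) + Re (trace (\<Psi> Q))"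
    using assms(1) PQ by (intro add_mono norm_le_trace_positive) (auto simp: stochastic_map_def)
  also have "\<dots> = Re (trace P) + Re (trace Q)" using assms(1) by (simp add: stochastic_map_def)
  finally show ?thesis using PQ(4) by simp
qed

section \<open>Lindblad generators\<close>

lemma map_matrix_mult:
  "map_matrix ((*) c) A ** B = map_matrix ((*) c) (A ** B)"
  "A ** map_matrix ((*) c) B = map_matrix ((*) c) (A ** (B :: 'n::finite op))"
  "adj (map_matrix ((*) c) A) = map_matrix ((*) (cnj c)) (adj A)"
  by (simp_all add: vec_eq_iff matrix_matrix_mult_def sum_distrib_left mult_ac)

text \<open>The Hamiltonian and the anticommutator merge into one operator \<open>W\<close>, namely
  i times H plus half the sum of \<open>adj (J j) ** J j\<close>. The relation for
  \<open>W + adj W\<close> encodes trace preservation.\<close>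

lemma lindbladian_form:
  assumes "lindbladian L"
  obtains J :: "nat \<Rightarrow> 'n::finite op" and n :: nat and W :: "'n op" where
    "L = (\<lambda>\<rho>. (\<Sum>j = 1..n. J j ** \<rho> ** adj (J j)) - W ** \<rho> - \<rho> ** adj W)"
    "W + adj W = (\<Sum>j = 1..n. adj (J j) ** J j)"
proof -
  obtain H n and J :: "nat \<Rightarrow> 'n op" where H: "adj H = H"
    and L: "\<And>\<rho>. L \<rho> = map_matrix ((*) (- \<i>)) (H ** \<rho> - \<rho> ** H) +
       (\<Sum>j = 1..n. J j ** \<rho> ** adj (J j)
          - (1/2) *\<^sub>R (adj (J j) ** J j ** \<rho> + \<rho> ** adj (J j) ** J j))"
    using assms unfolding lindbladian_def hermitian_def by blast
  define S where "S = (\<Sum>j = 1..n. adj (J j) ** J j)"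
  define W where "W = map_matrix ((*) \<i>) H + (1/2) *\<^sub>R S"
  have S: "adj S = S" by (simp add: S_def adj_sum adj_mult)
  have aW: "adj W = map_matrix ((*) (- \<i>)) H + (1/2) *\<^sub>R S"
    by (simp add: W_def adj_add adj_scaleR map_matrix_mult H S)
  show thesis
  proof
    show "W + adj W = (\<Sum>j = 1..n. adj (J j) ** J j)"
      unfolding aW unfolding W_def S_def[symmetric] by (simp add: vec_eq_iff)
    have "(\<Sum>j = 1..n. J j ** \<rho> ** adj (J j)
          - (1/2) *\<^sub>R (adj (J j) ** J j ** \<rho> + \<rho> ** adj (J j) ** J j)) =
        (\<Sum>j = 1..n. J j ** \<rho> ** adj (J j)) - (1/2) *\<^sub>R (S ** \<rho> + \<rho> ** S)" for \<rho>
      by (simp add: S_def matrix_sum_left matrix_sum_right sum_subtractf sum.distrib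
          scaleR_sum_right[symmetric] matrix_mul_assoc)
    moreover have "map_matrix ((*) (- \<i>)) (H ** \<rho> - \<rho> ** H) =
        - (map_matrix ((*) \<i>) H ** \<rho>) - \<rho> ** map_matrix ((*) (- \<i>)) H" for \<rho>
      unfolding map_matrix_mult by (simp add: vec_eq_iff algebra_simps)
    ultimately show "L = (\<lambda>\<rho>. (\<Sum>j = 1..n. J j ** \<rho> ** adj (J j)) - W ** \<rho> - \<rho> ** adj W)"
      unfolding aW
      by (simp add: fun_eq_iff L W_def matrix_add_ldistrib matrix_add_rdistrib matrix_scaleR_left matrix_scaleR_right
          scaleR_add_right)
  qed
qed

lemma linear_lindbladian:
  assumes "lindbladian L" shows "linear L"
proof (rule lindbladian_form[OF assms])
  fix J :: "nat \<Rightarrow> 'a op" and n W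
  assume "L = (\<lambda>\<rho>. (\<Sum>j = 1..n. J j ** \<rho> ** adj (J j)) - W ** \<rho> - \<rho> ** adj W)"
  then show ?thesis
    by (simp add: linear_iff matrix_add_ldistrib matrix_add_rdistrib matrix_scaleR_left matrix_scaleR_right
        sum.distrib scaleR_sum_right scaleR_diff_right)
qed

lemma lindbladian_adj:
  assumes "lindbladian L" shows "L (adj \<rho>) = adj (L \<rho>)"
proof (rule lindbladian_form[OF assms])
  fix J :: "nat \<Rightarrow> 'a op" and n W
  assume "L = (\<lambda>\<rho>. (\<Sum>j = 1..n. J j ** \<rho> ** adj (J j)) - W ** \<rho> - \<rho> ** adj W)"
  then show ?thesis by (simp add: adj_diff adj_sum adj_mult matrix_mul_assoc)
qed

lemma trace_lindbladian:
  assumes "lindbladian L" shows "Re (trace (L \<rho>)) = 0"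
proof (rule lindbladian_form[OF assms])
  fix J :: "nat \<Rightarrow> 'a op" and n W
  assume L: "L = (\<lambda>\<rho>. (\<Sum>j = 1..n. J j ** \<rho> ** adj (J j)) - W ** \<rho> - \<rho> ** adj W)"
    and W: "W + adj W = (\<Sum>j = 1..n. adj (J j) ** J j)"
  have "Re (trace (J j ** \<rho> ** adj (J j))) = Re (trace (adj (J j) ** J j ** \<rho>))" for j
    by (metis matrix_mul_assoc trace_mul_sym)
  then have "Re (trace (L \<rho>)) = Re (trace ((\<Sum>j = 1..n. adj (J j) ** J j) ** \<rho>))
      - Re (trace (W ** \<rho>)) - Re (trace (adj W ** \<rho>))"
    unfolding L Re_trace_simps matrix_sum_left by (simp add: trace_mul_sym[of \<rho>])
  also have "\<dots> = 0" unfolding W[symmetric] matrix_add_rdistrib Re_trace_simps by simp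
  finally show ?thesis .
qed

text \<open>With \<open>L \<rho> = \<Sum>\<^sub>j J\<^sub>j \<rho> J\<^sub>j\<^sup>* - W \<rho> - \<rho> W\<^sup>*\<close>, the completely positive map
  \<open>(1 - hW) \<rho> (1 - hW)\<^sup>* + h \<Sum>\<^sub>j J\<^sub>j \<rho> J\<^sub>j\<^sup>*\<close> is \<open>\<rho> + h L \<rho>\<close> up to \<open>O(h\<^sup>2)\<close>.  Its trace defect
  \<open>h\<^sup>2 tr(W \<rho> W\<^sup>*)\<close> is topped up to \<open>c h\<^sup>2 tr \<rho>\<close> by a multiple of a fixed state and then normalised away.\<close>

lemma lindbladian_euler_step:
  fixes L :: "'n::finite op \<Rightarrow> 'n op" and \<tau> :: "'n op"
  assumes "lindbladian L" "\<tau> \<in> states"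
  obtains C where "0 \<le> C" "\<And>h. 0 \<le> h \<Longrightarrow> h \<le> 1 \<Longrightarrow>
    \<exists>\<Psi>. stochastic_map \<Psi> \<and> (\<forall>y. norm (\<Psi> y - (y + h *\<^sub>R L y)) \<le> C * h\<^sup>2 * norm y)"
proof -
  obtain J :: "nat \<Rightarrow> 'n op" and n W where
    L: "L = (\<lambda>\<rho>. (\<Sum>j = 1..n. J j ** \<rho> ** adj (J j)) - W ** \<rho> - \<rho> ** adj W)"
    "W + adj W = (\<Sum>j = 1..n. adj (J j) ** J j)"
    using lindbladian_form[OF assms(1)] .
  \<comment> \<open>For positive \<open>P\<close> the trace of \<open>W ** P ** adj W\<close> is the
    inner product of \<open>adj W ** W\<close> with \<open>P\<close>, so by Cauchy-Schwarz it is at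
    most \<open>c\<close> times the trace of \<open>P\<close>. This makes \<open>m P\<close>
    nonnegative.\<close>
  define c where "c = norm (adj W ** W)"
  define m where "m = (\<lambda>z. c * Re (trace z) - Re (trace (W ** z ** adj W)))"
  define M where "M = (\<lambda>z. W ** z ** adj W + m z *\<^sub>R \<tau>)"
  have m_pos: "0 \<le> m P" if "positive_op P" for P
  proof -
    have "Re (trace (W ** P ** adj W)) = Re (trace (adj W ** W ** P))"
      by (metis matrix_mul_assoc trace_mul_sym)
    also have "\<dots> = (adj W ** W) \<bullet> P"
      by (simp add: inner_matrix adj_mult)
    also have "\<dots> \<le> c * norm P" unfolding c_def by (rule norm_cauchy_schwarz)
    also have "\<dots> \<le> c * Re (trace P)"
      using norm_le_trace_positive[OF that] by (simp add: c_def mult_left_mono)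
    finally show ?thesis by (simp add: m_def)
  qed
  have m_lin: "linear m"
    by (simp add: linear_iff m_def matrix_add_ldistrib matrix_add_rdistrib matrix_scaleR_left
        matrix_scaleR_right Re_trace_simps algebra_simps)
  have M_lin: "linear M"
    by (simp add: linear_iff M_def linear_add[OF m_lin] linear_scale[OF m_lin] matrix_add_ldistrib
        matrix_add_rdistrib matrix_scaleR_left matrix_scaleR_right algebra_simps)
  have L_lin: "linear L" by (rule linear_lindbladian[OF assms(1)])
  have \<tau>: "positive_op \<tau>" "Re (trace \<tau>) = 1" using assms(2) by (auto simp: states_iff)
  have M_tr: "Re (trace (M z)) = c * Re (trace z)" for z
    by (simp add: M_def m_def Re_trace_simps \<tau>)
  obtain KL where KL: "KL > 0" "\<And>z. norm (L z) \<le> norm z * KL"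
    using bounded_linear.pos_bounded L_lin linear_conv_bounded_linear by blast
  obtain KM where KM: "KM > 0" "\<And>z. norm (M z) \<le> norm z * KM"
    using bounded_linear.pos_bounded M_lin linear_conv_bounded_linear by blast
  have c: "c \<ge> 0" by (simp add: c_def)
  define C where "C = KM + c * (1 + KL)"
  have "\<exists>\<Psi>. stochastic_map \<Psi> \<and> (\<forall>y. norm (\<Psi> y - (y + h *\<^sub>R L y)) \<le> C * h\<^sup>2 * norm y)"
    if h: "0 \<le> h" "h \<le> 1" for h
  proof -
    define B where "B = mat 1 - h *\<^sub>R W"
    \<comment> \<open>The unnormalised step multiplies the real trace by \<open>q\<close>: the
      values of \<open>L\<close> have real trace zero, and \<open>M\<close> multiplies the real
      trace by \<open>c\<close>.\<close>
    define q where "q = 1 + c * h\<^sup>2"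
    define \<Psi> where "\<Psi> = (\<lambda>z. (1 / q) *\<^sub>R (z + h *\<^sub>R L z + h\<^sup>2 *\<^sub>R M z))"
    have q: "q \<ge> 1" using c by (simp add: q_def)
    have eq: "z + h *\<^sub>R L z + h\<^sup>2 *\<^sub>R M z =
        B ** z ** adj B + (h *\<^sub>R (\<Sum>j = 1..n. J j ** z ** adj (J j)) + (h\<^sup>2 * m z) *\<^sub>R \<tau>)" for z
      by (simp add: L M_def B_def adj_diff adj_scaleR matrix_diff_ldistrib matrix_diff_rdistrib
          matrix_scaleR_left matrix_scaleR_right algebra_simps power2_eq_square)
    have "positive_op (\<Psi> P)" if "positive_op P" for P
      unfolding \<Psi>_def eq using that q m_pos[OF that] h \<tau>
      by (intro positive_scaleR positive_add positive_sum positive_conj) auto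
    moreover have "Re (trace (\<Psi> z)) = Re (trace z)" for z
    proof -
      have "Re (trace (\<Psi> z)) = (1 / q) * (q * Re (trace z))"
        unfolding \<Psi>_def Re_trace_simps trace_lindbladian[OF assms(1)] M_tr by (simp add: q_def algebra_simps)
      then show ?thesis using q by simp
    qed
    moreover have "linear \<Psi>"
      by (simp add: linear_iff \<Psi>_def linear_add[OF L_lin] linear_scale[OF L_lin] linear_add[OF M_lin]
          linear_scale[OF M_lin] algebra_simps)
    moreover have "norm (\<Psi> y - (y + h *\<^sub>R L y)) \<le> C * h\<^sup>2 * norm y" for y
    proof -
      have q\<Psi>: "q *\<^sub>R \<Psi> y = y + h *\<^sub>R L y + h\<^sup>2 *\<^sub>R M y"
        using q by (simp add: \<Psi>_def)
      \<comment> \<open>Undoing the normalisation exposes the factor \<open>h\<^sup>2\<close>; then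
        \<open>q \<ge> 1\<close> and \<open>h \<le> 1\<close> lead to the constant
        \<open>C\<close>.\<close>
      have "q *\<^sub>R (\<Psi> y - (y + h *\<^sub>R L y)) = h\<^sup>2 *\<^sub>R (M y - c *\<^sub>R (y + h *\<^sub>R L y))"
        unfolding scaleR_diff_right q\<Psi> by (simp add: q_def algebra_simps)
      from arg_cong[OF this, of norm]
      have qn: "q * norm (\<Psi> y - (y + h *\<^sub>R L y)) = h\<^sup>2 * norm (M y - c *\<^sub>R (y + h *\<^sub>R L y))"
        using q by simp
      have Mn: "norm (M y - c *\<^sub>R (y + h *\<^sub>R L y)) \<le> C * norm y"
      proof -
        have "norm (M y - c *\<^sub>R (y + h *\<^sub>R L y)) \<le> norm (M y) + c * (norm y + h * norm (L y))"
          using c h by (intro order_trans[OF norm_triangle_ineq4] add_mono)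
            (auto intro!: mult_left_mono order_trans[OF norm_triangle_ineq])
        also have "\<dots> \<le> norm y * KM + c * (norm y + 1 * (norm y * KL))"
          using KL KM c h by (intro add_mono mult_left_mono mult_mono) auto
        finally show ?thesis by (simp add: C_def algebra_simps)
      qed
      have "norm (\<Psi> y - (y + h *\<^sub>R L y)) \<le> q * norm (\<Psi> y - (y + h *\<^sub>R L y))"
        using q mult_right_mono[of 1 q "norm (\<Psi> y - (y + h *\<^sub>R L y))"] by simp
      also have "\<dots> \<le> h\<^sup>2 * (C * norm y)"
        unfolding qn by (rule mult_left_mono[OF Mn]) simp
      finally show ?thesis by (simp only: mult_ac)
    qed
    ultimately show ?thesis unfolding stochastic_map_def by blast
  qed
  moreover have "0 \<le> C" using KL KM c by (simp add: C_def)
  ultimately show thesis using that by blast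
qed


section \<open>Invariance of the exterior of the ball\<close>

lemma stochastic_map_hermitian:
  assumes "stochastic_map \<Psi>" "hermitian y"
  shows "hermitian (\<Psi> y)"
proof -
  obtain P Q where "positive_op P" "positive_op Q" "y = P - Q"
    using hermitian_decomposition[OF assms(2)] by metis
  with assms(1) show ?thesis
    by (simp add: stochastic_map_def linear_diff hermitian_diff positive_hermitian)
qed

lemma lindbladian_hermitian: "lindbladian L \<Longrightarrow> hermitian y \<Longrightarrow> hermitian (L y)"
  using lindbladian_adj[of L y] by (simp add: hermitian_def)

lemma linear_bound:
  fixes L :: "'n::finite op \<Rightarrow> 'n op"
  assumes "linear L"
  obtains K where "0 \<le> K" "\<And>z. norm (L z) \<le> K * norm z"
  using bounded_linear.nonneg_bounded[of L] assms linear_conv_bounded_linear[of L]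
  by (metis mult.commute)

text \<open>Phrased with the p-th power of the distance, whose gradient is explicit. The strict
  inequality leaves a positive excess to absorb the error of a step.\<close>

definition exterior :: "real \<Rightarrow> 'n::finite op \<Rightarrow> real \<Rightarrow> 'n op set" where
  "exterior p \<sigma> \<epsilon> = {z \<in> states. \<epsilon> powr p < trace_power p (z - \<sigma>)}"

text \<open>The boundary hypothesis extends to the exterior with a defect proportional to the excess:
  retracting an exterior state radially towards \<open>\<sigma>\<close> stays inside the convex set of states, reaches
  the sphere, and only rescales the gradient.\<close>

lemma exterior_outward:
  fixes \<sigma> :: "'n::finite op"
  assumes p: "1 < p" and \<epsilon>: "0 < \<epsilon>" and \<sigma>: "\<sigma> \<in> states" and L: "linear L"
    and K: "0 \<le> K" "\<And>z. norm (L z) \<le> K * norm z"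
    and out: "\<And>\<eta>. \<eta> \<in> state_sphere p \<sigma> \<epsilon> \<Longrightarrow> 0 \<le> Re (trace (L \<eta> ** signed_power p (\<eta> - \<sigma>)))"
    and z: "z \<in> exterior p \<sigma> \<epsilon>"
  shows "- (2 * K * (CARD('n) * 2 powr (p - 1)) / \<epsilon> powr p) * (trace_power p (z - \<sigma>) - \<epsilon> powr p)
    \<le> L z \<bullet> signed_power p (z - \<sigma>)"
proof -
  define x where "x = z - \<sigma>"
  define f where "f = trace_power p x"
  define G where "G = signed_power p x"
  \<comment> \<open>Chosen so that \<open>c *\<^sub>R x\<close> has Schatten norm exactly
    \<epsilon>, which puts \<open>z'\<close> on the sphere.\<close>
  define c where "c = \<epsilon> / f powr (1 / p)"
  define z' where "z' = \<sigma> + c *\<^sub>R x"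
  have zs: "z \<in> states" and f: "\<epsilon> powr p < f"
    using z by (auto simp: exterior_def f_def x_def)
  have x: "hermitian x" using zs \<sigma> by (simp add: x_def hermitian_diff states_hermitian)
  have f0: "0 < f" using f by (meson order_le_less_trans powr_ge_zero)
  have "(\<epsilon> powr p) powr (1 / p) < f powr (1 / p)"
    using f p by (intro powr_less_mono2) auto
  then have \<epsilon>f: "\<epsilon> < f powr (1 / p)" using p \<epsilon> by (simp add: powr_powr)
  have c: "0 < c" "c < 1" using \<epsilon> f0 \<epsilon>f by (auto simp: c_def)
  have cp: "c powr p = \<epsilon> powr p / f"
    using \<epsilon> f0 p by (simp add: c_def powr_divide powr_powr)
  have "z' = (1 - c) *\<^sub>R \<sigma> + c *\<^sub>R z" by (simp add: z'_def x_def algebra_simps)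
  then have z's: "z' \<in> states"
    using convexD_alt[OF convex_states \<sigma> zs, of c] c by simp
  have "\<sigma> - z' = - (c *\<^sub>R x)" by (simp add: z'_def)
  then have "trace_power p (\<sigma> - z') = \<epsilon> powr p"
    using c x cp f0 by (simp add: trace_power_uminus hermitian_scaleR trace_power_scaleR f_def[symmetric])
  then have "schatten_norm p (\<sigma> - z') = \<epsilon>"
    using p \<epsilon> by (simp add: schatten_norm_trace_power powr_powr)
  with z's have "z' \<in> state_sphere p \<sigma> \<epsilon>" by (simp add: state_sphere_def)
  moreover have "z' - \<sigma> = c *\<^sub>R x" by (simp add: z'_def)
  ultimately have "0 \<le> Re (trace (signed_power p (c *\<^sub>R x) ** L z'))"
    using out trace_mul_sym[of "L z'"] by metis
  also have "\<dots> = signed_power p (c *\<^sub>R x) \<bullet> L z'"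
    using hermitian_signed_power[OF hermitian_scaleR[OF x], of p c]
    by (simp add: inner_matrix hermitian_def)
  also have "\<dots> = c powr (p - 1) * (L z' \<bullet> G)"
    using c x by (simp add: signed_power_scaleR G_def inner_commute)
  finally have 1: "0 \<le> L z' \<bullet> G" using c by (simp add: zero_le_mult_iff)
  have "norm x \<le> 2"
    using norm_triangle_ineq4[of z \<sigma>] norm_state_le[OF zs] norm_state_le[OF \<sigma>] by (simp add: x_def)
  then have Lx: "norm (L x) \<le> K * 2"
    using K mult_left_mono[of "norm x" 2 K] by (meson order_trans)
  have "norm G \<le> CARD('n) * norm x powr (p - 1)"
    unfolding G_def using x p by (intro norm_signed_power_le) auto
  also have "\<dots> \<le> CARD('n) * 2 powr (p - 1)"
    using \<open>norm x \<le> 2\<close> p by (intro mult_left_mono powr_mono2) auto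
  finally have G: "norm G \<le> CARD('n) * 2 powr (p - 1)" .
  have "\<bar>L x \<bullet> G\<bar> \<le> norm (L x) * norm G" by (rule Cauchy_Schwarz_ineq2)
  also have "\<dots> \<le> K * 2 * (CARD('n) * 2 powr (p - 1))"
    using Lx G K by (intro mult_mono) auto
  finally have LxG: "- (2 * K * (CARD('n) * 2 powr (p - 1))) \<le> L x \<bullet> G" by simp
  \<comment> \<open>Hence \<open>1 - c\<close> is at most \<open>1 - c powr p\<close>, which is the
    excess divided by \<open>f\<close>.\<close>
  have "c powr p \<le> c powr 1" using c p by (intro powr_mono') auto
  then have "1 - c \<le> (f - \<epsilon> powr p) / f"
    using c cp f0 by (simp add: divide_simps) (simp add: algebra_simps)
  also have "\<dots> \<le> (f - \<epsilon> powr p) / \<epsilon> powr p"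
    using f \<epsilon> f0 by (intro divide_left_mono) auto
  finally have c1: "1 - c \<le> (f - \<epsilon> powr p) / \<epsilon> powr p" .
  \<comment> \<open>The term at \<open>z'\<close> pairs nonnegatively with the gradient, so only the
    radial displacement can contribute negatively.\<close>
  have "L z = L z' + (1 - c) *\<^sub>R L x"
    unfolding linear_scale[OF L, symmetric] linear_add[OF L, symmetric]
    by (intro arg_cong[where f = L]) (simp add: z'_def x_def algebra_simps)
  then have "L z \<bullet> G \<ge> (1 - c) * (L x \<bullet> G)"
    using 1 by (simp add: inner_add_left)
  moreover have "(1 - c) * (L x \<bullet> G) \<ge> (1 - c) * (- (2 * K * (CARD('n) * 2 powr (p - 1))))"
    using LxG c by (intro mult_left_mono) auto
  moreover have "(1 - c) * (2 * K * (CARD('n) * 2 powr (p - 1)))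
      \<le> (f - \<epsilon> powr p) / \<epsilon> powr p * (2 * K * (CARD('n) * 2 powr (p - 1)))"
    using c1 K by (intro mult_right_mono) auto
  ultimately show ?thesis by (simp add: f_def G_def x_def mult_ac)
qed

text \<open>By Klein's inequality the trace power lies above its tangent, so a lower bound needs
  only the first-order change. \<open>A\<close> comes from the defect in
  \<open>exterior_outward\<close>, \<open>B\<close> from the Euler error paired with a gradient of
  norm at most \<open>g\<close>.\<close>

lemma exterior_euler_step:
  fixes \<sigma> :: "'n::finite op"
  assumes p: "1 < p" and \<epsilon>: "0 < \<epsilon>" and \<sigma>: "\<sigma> \<in> states" and L: "linear L"
    and out: "\<And>\<eta>. \<eta> \<in> state_sphere p \<sigma> \<epsilon> \<Longrightarrow> 0 \<le> Re (trace (L \<eta> ** signed_power p (\<eta> - \<sigma>)))"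
    and C: "0 \<le> C"
  obtains A B where "0 \<le> A" "0 \<le> B"
    "\<And>h \<Psi> z. 0 \<le> h \<Longrightarrow> stochastic_map \<Psi> \<Longrightarrow>
      (\<And>y. norm (\<Psi> y - (y + h *\<^sub>R L y)) \<le> C * h\<^sup>2 * norm y) \<Longrightarrow> z \<in> exterior p \<sigma> \<epsilon> \<Longrightarrow>
      (1 - h * A) * (trace_power p (z - \<sigma>) - \<epsilon> powr p) - h\<^sup>2 * B
        \<le> trace_power p (\<Psi> z - \<sigma>) - \<epsilon> powr p"
proof -
  obtain K where K: "0 \<le> K" "\<And>z. norm (L z) \<le> K * norm z" using linear_bound[OF L] by metis
  define g where "g = CARD('n) * 2 powr (p - 1)"
  define A where "A = p * (2 * K * g / \<epsilon> powr p)"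
  define B where "B = p * (C * g)"
  have g: "0 \<le> g" by (simp add: g_def)
  show thesis
  proof
    show "0 \<le> A" "0 \<le> B" using p K g C by (auto simp: A_def B_def)
    fix h :: real and \<Psi> and z :: "'n op"
    assume h: "0 \<le> h" and \<Psi>: "stochastic_map \<Psi>"
      and err: "\<And>y. norm (\<Psi> y - (y + h *\<^sub>R L y)) \<le> C * h\<^sup>2 * norm y"
      and z: "z \<in> exterior p \<sigma> \<epsilon>"
    define G where "G = signed_power p (z - \<sigma>)"
    define R where "R = \<Psi> z - (z + h *\<^sub>R L z)"
    define \<delta> where "\<delta> = trace_power p (z - \<sigma>) - \<epsilon> powr p"
    have zs: "z \<in> states" using z by (simp add: exterior_def)
    have herm: "hermitian (z - \<sigma>)" "hermitian (\<Psi> z - \<sigma>)"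
      using zs \<sigma> stochastic_map_state[OF \<Psi> zs] by (simp_all add: hermitian_diff states_hermitian)
    have "norm (z - \<sigma>) \<le> 2"
      using norm_triangle_ineq4[of z \<sigma>] norm_state_le[OF zs] norm_state_le[OF \<sigma>] by simp
    then have "CARD('n) * norm (z - \<sigma>) powr (p - 1) \<le> g"
      unfolding g_def using p by (intro mult_left_mono powr_mono2) auto
    then have G: "norm G \<le> g"
      unfolding G_def using norm_signed_power_le[OF herm(1), of p] p by linarith
    have "norm R \<le> C * h\<^sup>2"
      using err[of z] norm_state_le[OF zs] C mult_left_mono[of "norm z" 1 "C * h\<^sup>2"]
      by (simp add: R_def)
    then have "norm R * norm G \<le> C * h\<^sup>2 * g"
      using G C by (intro mult_mono) auto
    then have RG: "- (C * h\<^sup>2 * g) \<le> R \<bullet> G"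
      using Cauchy_Schwarz_ineq2[of R G] by linarith
    have LG: "- (2 * K * g / \<epsilon> powr p) * \<delta> \<le> L z \<bullet> G"
      using exterior_outward[OF p \<epsilon> \<sigma> L K out z] by (simp add: g_def \<delta>_def G_def)
    have "(\<Psi> z - \<sigma>) - (z - \<sigma>) = h *\<^sub>R L z + R" by (simp add: R_def)
    then have "((\<Psi> z - \<sigma>) - (z - \<sigma>)) \<bullet> G = h * (L z \<bullet> G) + R \<bullet> G"
      by (simp only: inner_add_left inner_scaleR_left)
    moreover have "h * (- (2 * K * g / \<epsilon> powr p) * \<delta>) \<le> h * (L z \<bullet> G)"
      using LG h by (rule mult_left_mono)
    ultimately have "h * (- (2 * K * g / \<epsilon> powr p) * \<delta>) - C * h\<^sup>2 * g
        \<le> ((\<Psi> z - \<sigma>) - (z - \<sigma>)) \<bullet> G"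
      using RG by linarith
    then have "p * (h * (- (2 * K * g / \<epsilon> powr p) * \<delta>) - C * h\<^sup>2 * g)
        \<le> p * (((\<Psi> z - \<sigma>) - (z - \<sigma>)) \<bullet> G)"
      using p by (intro mult_left_mono) auto
    moreover have "p * (h * (- (2 * K * g / \<epsilon> powr p) * \<delta>) - C * h\<^sup>2 * g) = - (h * A) * \<delta> - h\<^sup>2 * B"
      by (simp add: A_def B_def algebra_simps)
    ultimately show "(1 - h * A) * (trace_power p (z - \<sigma>) - \<epsilon> powr p) - h\<^sup>2 * B
        \<le> trace_power p (\<Psi> z - \<sigma>) - \<epsilon> powr p"
      using trace_power_above_tangent[OF p herm] unfolding \<delta>_def[symmetric] G_def[symmetric]
      by (simp add: \<delta>_def algebra_simps)
  qed
qed

text \<open>All iterates share the norm bound \<open>CARD('n)\<close>, so errors add up without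
  growing exponentially. For \<open>H = k * h\<close> the total is second order in the elapsed time,
  whatever the number of steps.\<close>

lemma stochastic_map_funpow_error:
  fixes L :: "'n::finite op \<Rightarrow> 'n op" and K C h H :: real and k :: nat
  assumes \<Psi>: "stochastic_map \<Psi>" and L: "lindbladian L"
    and K: "0 \<le> K" "\<And>z. norm (L z) \<le> K * norm z" and C: "0 \<le> C" and h: "0 \<le> h" "h \<le> 1"
    and err: "\<And>y. norm (\<Psi> y - (y + h *\<^sub>R L y)) \<le> C * h\<^sup>2 * norm y"
    and y: "hermitian y" and k: "k * h \<le> H" "h \<le> H"
  shows "norm ((\<Psi> ^^ k) y - (y + (k * h) *\<^sub>R L y)) \<le> k * h * H * (CARD('n) * ((K + C) * K + C)) * norm y"
proof -
  define N where "N = real CARD('n)"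
  have N: "0 \<le> N" by (simp add: N_def)
  have lin: "linear (\<Psi> ^^ j)" for j
    using stochastic_map_funpow[OF \<Psi>] by (simp add: stochastic_map_def)
  have bound: "norm ((\<Psi> ^^ j) v) \<le> N * norm v" if "hermitian v" for j v
    using norm_stochastic_map_le[OF stochastic_map_funpow[OF \<Psi>] that] by (simp add: N_def)
  have drift: "norm ((\<Psi> ^^ j) v - v) \<le> j * h * (N * (K + C)) * norm v" if v: "hermitian v" for j v
  proof (induction j)
    case (Suc j)
    have "norm (\<Psi> v - v) \<le> norm (\<Psi> v - (v + h *\<^sub>R L v)) + h * norm (L v)"
      using norm_triangle_ineq[of "\<Psi> v - (v + h *\<^sub>R L v)" "h *\<^sub>R L v"] h by simp
    also have "\<dots> \<le> C * h\<^sup>2 * norm v + h * (K * norm v)"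
      using err K h by (intro add_mono mult_left_mono) auto
    also have "C * h\<^sup>2 * norm v \<le> C * (h * 1) * norm v"
      unfolding power2_eq_square using h C by (intro mult_left_mono mult_right_mono) auto
    finally have 1: "norm (\<Psi> v - v) \<le> h * (K + C) * norm v" by (simp add: algebra_simps)
    have "(\<Psi> ^^ Suc j) v - v = (\<Psi> ^^ j) (\<Psi> v - v) + ((\<Psi> ^^ j) v - v)"
      by (simp add: funpow_Suc_right linear_diff[OF lin] del: funpow.simps)
    then have "norm ((\<Psi> ^^ Suc j) v - v) \<le> norm ((\<Psi> ^^ j) (\<Psi> v - v)) + norm ((\<Psi> ^^ j) v - v)"
      by (simp only: norm_triangle_ineq)
    also have "\<dots> \<le> N * (h * (K + C) * norm v) + j * h * (N * (K + C)) * norm v"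
      using bound[OF hermitian_diff[OF stochastic_map_hermitian[OF \<Psi> v] v], of j] mult_left_mono[OF 1 N] Suc
      by linarith
    finally show ?case by (simp add: algebra_simps)
  qed simp
  define D where "D = H * (N * ((K + C) * K + C))"
  have "norm ((\<Psi> ^^ j) y - (y + (j * h) *\<^sub>R L y)) \<le> j * h * D * norm y" if "j \<le> k" for j
    using that
  proof (induction j)
    case (Suc j)
    define R where "R = \<Psi> y - (y + h *\<^sub>R L y)"
    have Ly: "hermitian (L y)" using L y by (rule lindbladian_hermitian)
    have "hermitian R"
      unfolding R_def using y Ly stochastic_map_hermitian[OF \<Psi> y]
      by (intro hermitian_diff hermitian_add hermitian_scaleR)
    then have 1: "norm ((\<Psi> ^^ j) R) \<le> N * (C * h\<^sup>2 * norm y)"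
      using bound[of R j] mult_left_mono[OF err[of y] N] by (simp add: R_def)
    have "real j * h \<le> H" using Suc.prems k(1) h mult_right_mono[of "real j" k h] by simp
    then have "j * h * (N * (K + C)) * norm (L y) \<le> H * (N * (K + C)) * (K * norm y)"
      using K C N h k(2) by (intro mult_mono mult_nonneg_nonneg add_nonneg_nonneg) auto
    then have 2: "norm ((\<Psi> ^^ j) (L y) - L y) \<le> H * (N * (K + C)) * (K * norm y)"
      using drift[OF Ly, of j] by linarith
    have "\<Psi> y = y + h *\<^sub>R L y + R" by (simp add: R_def)
    \<comment> \<open>Splitting off the first step leaves the earlier error, the drift of
      \<open>L y\<close> under the remaining iterates, and the propagated one-step error
      \<open>R\<close>.\<close>
    then have "(\<Psi> ^^ Suc j) y - (y + (Suc j * h) *\<^sub>R L y)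
        = ((\<Psi> ^^ j) y - (y + (j * h) *\<^sub>R L y)) + h *\<^sub>R ((\<Psi> ^^ j) (L y) - L y) + (\<Psi> ^^ j) R"
      by (simp add: funpow_Suc_right linear_add[OF lin] linear_scale[OF lin] algebra_simps del: funpow.simps)
    then have "norm ((\<Psi> ^^ Suc j) y - (y + (Suc j * h) *\<^sub>R L y))
        \<le> norm ((\<Psi> ^^ j) y - (y + (j * h) *\<^sub>R L y)) + norm (h *\<^sub>R ((\<Psi> ^^ j) (L y) - L y)) + norm ((\<Psi> ^^ j) R)"
      by (simp only:) (intro norm_triangle_mono order_refl)
    also have "\<dots> \<le> j * h * D * norm y + h * (H * (N * (K + C)) * (K * norm y)) + N * (C * h\<^sup>2 * norm y)"
      using Suc h by (intro add_mono 1) (auto intro: mult_left_mono[OF 2 h(1)])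
    also have "N * (C * h\<^sup>2 * norm y) \<le> N * (C * (h * H) * norm y)"
      unfolding power2_eq_square using N C h k(2) by (intro mult_left_mono mult_right_mono) auto
    finally show ?case by (simp add: D_def algebra_simps)
  qed simp
  from this[of k] show ?thesis by (simp add: D_def N_def algebra_simps)
qed

text \<open>A single Euler step may leave the open exterior, but sufficiently many shorter ones do not:
  the excess decays at most exponentially, while the accumulated second-order error vanishes.\<close>

lemma exterior_invariant_step:
  fixes \<sigma> :: "'n::finite op"
  assumes p: "1 < p" and \<epsilon>: "0 < \<epsilon>" and \<sigma>: "\<sigma> \<in> states" and L: "lindbladian L"
    and out: "\<And>\<eta>. \<eta> \<in> state_sphere p \<sigma> \<epsilon> \<Longrightarrow> 0 \<le> Re (trace (L \<eta> ** signed_power p (\<eta> - \<sigma>)))"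
  obtains r C where "0 < r" "0 \<le> C"
    "\<And>h z. 0 \<le> h \<Longrightarrow> h \<le> r \<Longrightarrow> z \<in> exterior p \<sigma> \<epsilon> \<Longrightarrow>
      \<exists>\<Phi>. stochastic_map \<Phi> \<and> \<Phi> z \<in> exterior p \<sigma> \<epsilon> \<and>
        (\<forall>y. hermitian y \<longrightarrow> norm (\<Phi> y - (y + h *\<^sub>R L y)) \<le> C * h\<^sup>2 * norm y)"
proof -
  have lin: "linear L" using L by (rule linear_lindbladian)
  obtain K where K: "0 \<le> K" "\<And>z. norm (L z) \<le> K * norm z" using linear_bound[OF lin] by metis
  obtain C where C: "0 \<le> C" and step: "\<And>h. 0 \<le> h \<Longrightarrow> h \<le> 1 \<Longrightarrow>
    \<exists>\<Psi>. stochastic_map \<Psi> \<and> (\<forall>y. norm (\<Psi> y - (y + h *\<^sub>R L y)) \<le> C * h\<^sup>2 * norm y)"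
    using lindbladian_euler_step[OF L \<sigma>] by blast
  obtain A B where A: "0 \<le> A" and B: "0 \<le> B" and
    excess: "\<And>h \<Psi> z. 0 \<le> h \<Longrightarrow> stochastic_map \<Psi> \<Longrightarrow>
      (\<And>y. norm (\<Psi> y - (y + h *\<^sub>R L y)) \<le> C * h\<^sup>2 * norm y) \<Longrightarrow> z \<in> exterior p \<sigma> \<epsilon> \<Longrightarrow>
      (1 - h * A) * (trace_power p (z - \<sigma>) - \<epsilon> powr p) - h\<^sup>2 * B
        \<le> trace_power p (\<Psi> z - \<sigma>) - \<epsilon> powr p"
    using exterior_euler_step[OF p \<epsilon> \<sigma> lin out C] by blast
  define D where "D = CARD('n) * ((K + C) * K + C)"
  \<comment> \<open>For \<open>h \<le> r\<close> this gives both \<open>h * A \<le> 1 / 2\<close>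
    and \<open>h \<le> 1\<close>.\<close>
  define r where "r = 1 / (2 * A + 1)"
  have "0 < r" using A by (simp add: r_def)
  moreover have "0 \<le> D" using K C by (simp add: D_def)
  moreover have "\<exists>\<Phi>. stochastic_map \<Phi> \<and> \<Phi> z \<in> exterior p \<sigma> \<epsilon> \<and>
        (\<forall>y. hermitian y \<longrightarrow> norm (\<Phi> y - (y + h *\<^sub>R L y)) \<le> D * h\<^sup>2 * norm y)"
    if h: "0 \<le> h" "h \<le> r" and z: "z \<in> exterior p \<sigma> \<epsilon>" for h z
  proof -
    define \<delta> where "\<delta> = (\<lambda>w. trace_power p (w - \<sigma>) - \<epsilon> powr p)"
    have \<delta>0: "0 < \<delta> z" using z by (simp add: exterior_def \<delta>_def)
    \<comment> \<open>With \<open>n\<close> substeps the accumulated error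
      \<open>h\<^sup>2 * B / n\<close> stays below half the excess. The number depends on
      \<open>z\<close>, whereas \<open>r\<close> and \<open>D\<close> do not.\<close>
    obtain n :: nat where n: "h * h * B * 2 / \<delta> z < n" using reals_Archimedean2 by blast
    have "0 \<le> h * h * B * 2 / \<delta> z" using h B \<delta>0 by simp
    then have n0: "0 < real n" using n by linarith
    define \<eta> where "\<eta> = h / n"
    have \<eta>n: "n * \<eta> = h" using n0 by (simp add: \<eta>_def)
    have n1: "1 \<le> real n" using n0 by simp
    have \<eta>: "0 \<le> \<eta>" "\<eta> \<le> h"
      using h n0 mult_right_mono[OF n1, of \<eta>] \<eta>n by (auto simp: \<eta>_def)
    have hA: "h * A \<le> 1 / 2" "h \<le> 1"
    proof -
      have "h * A \<le> 1 / (2 * A + 1) * A" using h A unfolding r_def by (intro mult_right_mono) auto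
      also have "\<dots> \<le> 1 / 2" using A by (simp add: divide_simps)
      finally show "h * A \<le> 1 / 2" .
      have "r \<le> 1" using A by (simp add: r_def)
      with h show "h \<le> 1" by simp
    qed
    have hB: "h * \<eta> * B < \<delta> z / 2"
      using n n0 \<delta>0 by (simp add: \<eta>_def divide_simps mult_ac)
    obtain \<Psi> where \<Psi>: "stochastic_map \<Psi>"
      and err: "\<And>y. norm (\<Psi> y - (y + \<eta> *\<^sub>R L y)) \<le> C * \<eta>\<^sup>2 * norm y"
      using step[of \<eta>] \<eta> hA by auto
    have "(\<Psi> ^^ k) z \<in> exterior p \<sigma> \<epsilon> \<and> (1 - k * \<eta> * A) * \<delta> z - k * \<eta>\<^sup>2 * B \<le> \<delta> ((\<Psi> ^^ k) z)"
      if "k \<le> n" for k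
      using that
    proof (induction k)
      case 0
      show ?case using z by simp
    next
      case (Suc k)
      let ?w = "(\<Psi> ^^ k) z"
      let ?m = "real (Suc k)"
      have w: "?w \<in> exterior p \<sigma> \<epsilon>"
        and IH: "(1 - k * \<eta> * A) * \<delta> z - k * \<eta>\<^sup>2 * B \<le> \<delta> ?w"
        using Suc by auto
      have m: "?m * \<eta> \<le> h" using Suc.prems \<eta> mult_right_mono[of ?m n \<eta>] by (simp only: \<eta>n of_nat_le_iff)
      have \<eta>A: "0 \<le> 1 - \<eta> * A" "1 - \<eta> * A \<le> 1"
        using hA \<eta> A mult_right_mono[of \<eta> h A] by (auto intro: mult_nonneg_nonneg)
      have "(1 - \<eta> * A) * ((1 - k * \<eta> * A) * \<delta> z - k * \<eta>\<^sup>2 * B) - \<eta>\<^sup>2 * B \<le> (1 - \<eta> * A) * \<delta> ?w - \<eta>\<^sup>2 * B"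
        using IH \<eta>A by (intro diff_right_mono mult_left_mono) auto
      also have "\<dots> \<le> \<delta> (\<Psi> ?w)"
        using excess[OF \<eta>(1) \<Psi> err w] by (simp add: \<delta>_def)
      \<comment> \<open>As in Bernoulli's inequality, expanding the product adds only nonnegative
        terms.\<close>
      also have "(1 - \<eta> * A) * ((1 - k * \<eta> * A) * \<delta> z - k * \<eta>\<^sup>2 * B) - \<eta>\<^sup>2 * B
          = (1 - ?m * \<eta> * A) * \<delta> z - ?m * \<eta>\<^sup>2 * B + (k * (\<eta> * A)\<^sup>2 * \<delta> z + \<eta> * A * (k * \<eta>\<^sup>2 * B))"
        by (simp add: algebra_simps power2_eq_square)
      finally have lower: "(1 - ?m * \<eta> * A) * \<delta> z - ?m * \<eta>\<^sup>2 * B \<le> \<delta> (\<Psi> ?w)"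
        using \<eta> A B \<delta>0 by (smt (verit) mult_nonneg_nonneg of_nat_0_le_iff zero_le_power2)
      \<comment> \<open>At least half of the initial excess survives the decay, and
        \<open>hB\<close> keeps the accumulated error strictly below that half.\<close>
      have "?m * \<eta> * A \<le> 1 / 2" using mult_right_mono[OF m A] hA by simp
      then have "1 / 2 * \<delta> z \<le> (1 - ?m * \<eta> * A) * \<delta> z"
        using \<delta>0 by (intro mult_right_mono) auto
      moreover have "?m * \<eta>\<^sup>2 * B \<le> h * \<eta> * B"
      proof -
        have "?m * \<eta>\<^sup>2 * B = (?m * \<eta>) * (\<eta> * B)" by (simp add: power2_eq_square)
        also have "\<dots> \<le> h * (\<eta> * B)" using m \<eta> B by (intro mult_right_mono) auto
        finally show ?thesis by simp
      qed
      ultimately have "0 < \<delta> (\<Psi> ?w)" using lower hB by linarith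
      moreover have "\<Psi> ?w \<in> states"
        using stochastic_map_state[OF \<Psi>] w by (simp add: exterior_def)
      ultimately have "\<Psi> ?w \<in> exterior p \<sigma> \<epsilon>" by (simp add: exterior_def \<delta>_def)
      with lower show ?case by simp
    qed
    moreover have "norm ((\<Psi> ^^ n) y - (y + h *\<^sub>R L y)) \<le> D * h\<^sup>2 * norm y" if "hermitian y" for y
      using stochastic_map_funpow_error[OF \<Psi> L K C \<eta>(1) _ err that, of n h] \<eta> hA
      unfolding \<eta>n D_def[symmetric] by (simp add: power2_eq_square mult_ac)
    ultimately show ?thesis using stochastic_map_funpow[OF \<Psi>, of n] by blast
  qed
  ultimately show thesis using that by blast
qed


section \<open>Distance to an invariant set along weak solutions\<close>

text \<open>The admissible interval length \<open>r\<close> varies with the tag \<open>s\<close>, so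
  it defines a gauge. Over a fine tagged division the increments of \<open>d\<close> telescope, and
  the Henstock lemma makes the sum of the defects small although no single one need be small
  relative to its interval.\<close>

lemma mono_of_henstock_increments:
  fixes g :: "real \<Rightarrow> 'a::euclidean_space" and d :: "real \<Rightarrow> real"
  assumes g: "g integrable_on {0..T}" and T: "0 \<le> T" and C: "0 \<le> C"
    and step: "\<And>s e. s \<in> {0..T} \<Longrightarrow> 0 < e \<Longrightarrow> \<exists>r>0. \<forall>a b. 0 \<le> a \<and> a \<le> s \<and> s \<le> b \<and> b \<le> T \<and> b - a < r \<longrightarrow>
      d b \<le> d a + e * (b - a) + C * norm ((b - a) *\<^sub>R g s - integral {a..b} g)"
  shows "d T \<le> d 0"
proof (rule field_le_epsilon)
  fix e :: real assume e: "0 < e"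
  \<comment> \<open>The two budgets give \<open>e1 * T \<le> e / 2\<close> and
    \<open>C * e2 \<le> e / 2\<close>; the added 1 guards against \<open>T = 0\<close> and
    \<open>C = 0\<close>.\<close>
  define e1 where "e1 = e / (2 * (T + 1))"
  define e2 where "e2 = e / (2 * (C + 1))"
  have e12: "0 < e1" "0 < e2" using e T C by (auto simp: e1_def e2_def)
  obtain \<gamma> where \<gamma>: "gauge \<gamma>" and hen: "\<And>q. \<lbrakk>q tagged_partial_division_of (cbox 0 T); \<gamma> fine q\<rbrakk> \<Longrightarrow>
      (\<Sum>(x,k)\<in>q. norm (measure lborel k *\<^sub>R g x - integral k g)) < e2"
    using Henstock_lemma[of g 0 T e2] g e12 by auto
  have "\<forall>s. \<exists>r>0. s \<in> {0..T} \<longrightarrow> (\<forall>a b. 0 \<le> a \<and> a \<le> s \<and> s \<le> b \<and> b \<le> T \<and> b - a < r \<longrightarrow>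
      d b \<le> d a + e1 * (b - a) + C * norm ((b - a) *\<^sub>R g s - integral {a..b} g))"
    using step[OF _ e12(1)] by (metis zero_less_one)
  then obtain r where r: "\<And>s. 0 < r s" and rstep: "\<And>s a b. s \<in> {0..T} \<Longrightarrow> 0 \<le> a \<Longrightarrow> a \<le> s \<Longrightarrow>
      s \<le> b \<Longrightarrow> b \<le> T \<Longrightarrow> b - a < r s \<Longrightarrow>
      d b \<le> d a + e1 * (b - a) + C * norm ((b - a) *\<^sub>R g s - integral {a..b} g)"
    by metis
  \<comment> \<open>Half the radius suffices because the tag lies in its interval, whose length is
    then below \<open>r s\<close>.\<close>
  have "gauge (\<lambda>s. \<gamma> s \<inter> ball s (r s / 2))"
    using \<gamma> r by (auto simp: gauge_def)
  then obtain q where q: "q tagged_division_of (cbox 0 T)" and fine: "(\<lambda>s. \<gamma> s \<inter> ball s (r s / 2)) fine q"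
    using fine_division_exists by blast
  have fine\<gamma>: "\<gamma> fine q" using fine by (auto simp: fine_def)
  have "d T - d 0 = (\<Sum>(s,k)\<in>q. d (Sup k) - d (Inf k))"
    using additive_tagged_division_1[of 0 T q d] q T by simp
  also have "\<dots> \<le> (\<Sum>(s,k)\<in>q. e1 * measure lborel k + C * norm (measure lborel k *\<^sub>R g s - integral k g))"
  proof (rule sum_mono, clarify)
    fix s k assume sk: "(s, k) \<in> q"
    obtain a b where k: "k = cbox a b" using tagged_division_ofD(4)[OF q sk] by blast
    have s: "s \<in> k" and sub: "k \<subseteq> cbox 0 T"
      using tagged_division_ofD(2,3)[OF q sk] by auto
    have ab: "a \<le> s" "s \<le> b" using s k by auto
    have aT: "0 \<le> a" "b \<le> T" using sub ab by (auto simp: k)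
    have "k \<subseteq> ball s (r s / 2)" using fine sk by (auto simp: fine_def)
    moreover have "a \<in> k" "b \<in> k" using ab by (auto simp: k)
    ultimately have "dist s a < r s / 2" "dist s b < r s / 2" by auto
    then have "b - a < r s" using ab by (auto simp: dist_real_def)
    with rstep[of s a b] ab aT have "d b \<le> d a + e1 * (b - a) + C * norm ((b - a) *\<^sub>R g s - integral {a..b} g)"
      by auto
    with ab show "d (Sup k) - d (Inf k) \<le> e1 * measure lborel k + C * norm (measure lborel k *\<^sub>R g s - integral k g)"
      by (simp add: k)
  qed
  also have "\<dots> = e1 * (\<Sum>(s,k)\<in>q. measure lborel k) + C * (\<Sum>(s,k)\<in>q. norm (measure lborel k *\<^sub>R g s - integral k g))"
    by (simp add: sum.distrib sum_distrib_left case_prod_unfold)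
  also have "\<dots> \<le> e1 * T + C * e2"
  proof -
    have "(\<Sum>(s,k)\<in>q. measure lborel k) = T"
      using additive_content_tagged_division[OF q] T by simp
    moreover have "(\<Sum>(s,k)\<in>q. norm (measure lborel k *\<^sub>R g s - integral k g)) \<le> e2"
      using hen[of q] q fine\<gamma> by (simp add: tagged_division_of_def)
    ultimately show ?thesis using C by (simp add: mult_left_mono)
  qed
  also have "\<dots> \<le> e / 2 + e / 2"
    using e T C by (intro add_mono) (auto simp: e1_def e2_def field_simps)
  finally show "d T \<le> d 0 + e" by simp
qed

text \<open>For Hermitian \<open>x\<close>, the trace norm is the least \<open>tr P + tr Q\<close> over positive \<open>P\<close>, \<open>Q\<close> with
  \<open>x = P - Q\<close>; \<open>gap S x\<close> is the distance from \<open>x\<close> to \<open>S\<close> in this norm.\<close>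

definition gap_values :: "'n::finite op set \<Rightarrow> 'n op \<Rightarrow> real set" where
  "gap_values S x = {Re (trace P) + Re (trace Q) | P Q z.
     positive_op P \<and> positive_op Q \<and> z \<in> S \<and> x = z + P - Q}"

definition gap :: "'n::finite op set \<Rightarrow> 'n op \<Rightarrow> real" where
  "gap S x = Inf (gap_values S x)"

lemma gap_values_nonneg: "v \<in> gap_values S x \<Longrightarrow> 0 \<le> v"
  by (auto simp: gap_values_def trace_positive_nonneg)

lemma gap_le: "v \<in> gap_values S x \<Longrightarrow> gap S x \<le> v"
  unfolding gap_def by (rule cInf_lower) (auto intro: bdd_belowI[of _ 0] gap_values_nonneg)

lemma gap_values_nonempty:
  assumes "z \<in> S" "hermitian (x - z)"
  shows "gap_values S x \<noteq> {}"
proof -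
  obtain P Q where "positive_op P" "positive_op Q" "x - z = P - Q"
    using hermitian_decomposition[OF assms(2)] by metis
  moreover from this(3) have "x = z + P - Q" by (simp add: algebra_simps)
  ultimately show ?thesis using assms(1) unfolding gap_values_def by blast
qed

lemma gap_self: "x \<in> S \<Longrightarrow> gap S x \<le> 0"
  by (intro gap_le, unfold gap_values_def, intro CollectI exI[of _ 0] exI[of _ x])
    (simp add: linear_0[OF linear_Re_trace])

text \<open>The infimum need not be attained, so a gap of zero yields only approximating points of
  \<open>S\<close>. The traces of \<open>P\<close> and \<open>Q\<close> bound their Frobenius
  norms.\<close>

lemma near_of_gap:
  assumes "gap S x \<le> 0" "gap_values S x \<noteq> {}" "0 < \<delta>"
  obtains z where "z \<in> S" "norm (x - z) < \<delta>"
proof -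
  obtain v where v: "v \<in> gap_values S x" "v < \<delta>"
    using cInf_lessD[OF assms(2), of \<delta>] assms(1,3) unfolding gap_def by auto
  then obtain P Q z where *: "positive_op P" "positive_op Q" "z \<in> S" "x = z + P - Q"
    "v = Re (trace P) + Re (trace Q)"
    by (auto simp: gap_values_def)
  have "norm (x - z) \<le> norm P + norm Q"
    using * by (simp add: norm_triangle_ineq4)
  also have "\<dots> \<le> v"
    using * by (auto intro: add_mono norm_le_trace_positive)
  finally show thesis using that * v by force
qed

text \<open>Stochastic maps contract the trace norm, so the first-order flow of a map leaving \<open>S\<close> invariant
  cannot increase the distance to \<open>S\<close>.\<close>

lemma gap_step:
  fixes S :: "'n::finite op set" and w y :: "'n op" and e :: real
  assumes inv: "\<And>z. z \<in> S \<Longrightarrow> \<exists>\<Phi>. stochastic_map \<Phi> \<and> \<Phi> z \<in> S \<and> norm (w - \<Phi> y) \<le> e"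
    and S: "\<And>z. z \<in> S \<Longrightarrow> hermitian z" "S \<noteq> {}" and y: "hermitian y" and w: "hermitian w"
  shows "gap S w \<le> gap S y + CARD('n) * e"
proof -
  have "gap S w - CARD('n) * e \<le> v" if v: "v \<in> gap_values S y" for v
  proof -
    obtain P Q z where *: "positive_op P" "positive_op Q" "z \<in> S" "y = z + P - Q"
      "v = Re (trace P) + Re (trace Q)"
      using v by (auto simp: gap_values_def)
    \<comment> \<open>The map may depend on the competitor \<open>z\<close>; only the error at
      \<open>y\<close> has to be uniform.\<close>
    obtain \<Phi> where \<Phi>: "stochastic_map \<Phi>" "\<Phi> z \<in> S" "norm (w - \<Phi> y) \<le> e"
      using inv[OF *(3)] by blast
    have lin: "linear \<Phi>" and pos: "\<And>P. positive_op P \<Longrightarrow> positive_op (\<Phi> P)"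
      and tr: "\<And>P. Re (trace (\<Phi> P)) = Re (trace P)"
      using \<Phi>(1) by (auto simp: stochastic_map_def)
    have "hermitian (w - \<Phi> y)"
      using w stochastic_map_hermitian[OF \<Phi>(1) y] by (rule hermitian_diff)
    then obtain P' Q' where PQ': "positive_op P'" "positive_op Q'" "w - \<Phi> y = P' - Q'"
      "Re (trace P') + Re (trace Q') \<le> CARD('n) * norm (w - \<Phi> y)"
      using hermitian_decomposition by metis
    \<comment> \<open>The decomposition of \<open>y\<close> is transported by \<open>\<Phi>\<close>
      at unchanged trace, and the Jordan parts of the error are added to it.\<close>
    have "w = \<Phi> y + (P' - Q')" using PQ'(3) by (simp add: algebra_simps)
    then have "w = \<Phi> z + (\<Phi> P + P') - (\<Phi> Q + Q')"
      by (simp add: *(4) linear_add[OF lin] linear_diff[OF lin])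
    moreover have "positive_op (\<Phi> P + P')" "positive_op (\<Phi> Q + Q')"
      using * PQ' pos by (auto intro: positive_add)
    ultimately have "Re (trace (\<Phi> P + P')) + Re (trace (\<Phi> Q + Q')) \<in> gap_values S w"
      using \<Phi>(2) unfolding gap_values_def by blast
    from gap_le[OF this] have "gap S w \<le> v + (Re (trace P') + Re (trace Q'))"
      by (simp add: Re_trace_simps tr *(5))
    also have "\<dots> \<le> v + CARD('n) * e"
      using PQ'(4) \<Phi>(3) mult_left_mono[OF \<Phi>(3), of "real CARD('n)"] by linarith
    finally show ?thesis by simp
  qed
  moreover have "gap_values S y \<noteq> {}"
    using S y gap_values_nonempty[of _ S y] hermitian_diff by blast
  ultimately have "gap S w - CARD('n) * e \<le> gap S y"
    unfolding gap_def[of S y] by (intro cInf_greatest)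
  then show ?thesis by simp
qed


section \<open>Non-reachability\<close>

lemma schatten_norm_scaleR:
  assumes "hermitian A" "0 \<le> r" "0 < p"
  shows "schatten_norm p (r *\<^sub>R A) = r * schatten_norm p A"
  using assms trace_power_nonneg[OF assms(1), of p]
  by (simp add: schatten_norm_trace_power trace_power_scaleR powr_mult powr_powr)

text \<open>A state outside the closure lies farther than \<epsilon> from \<sigma>: at distance at
  most \<epsilon> it would be the limit of its contractions towards \<sigma>, which all lie in the
  open ball.\<close>

lemma exterior_nonempty:
  assumes p: "1 < p" and \<epsilon>: "0 < \<epsilon>" and \<sigma>: "\<sigma> \<in> states" and cl: "closure (state_ball p \<sigma> \<epsilon>) \<subset> states"
  obtains z where "z \<in> exterior p \<sigma> \<epsilon>"
proof -
  obtain z where z: "z \<in> states" "z \<notin> closure (state_ball p \<sigma> \<epsilon>)" using cl by blast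
  have herm: "hermitian (\<sigma> - z)" using z \<sigma> by (simp add: hermitian_diff states_hermitian)
  have "\<epsilon> < schatten_norm p (\<sigma> - z)"
  proof (rule ccontr)
    assume *: "\<not> \<epsilon> < schatten_norm p (\<sigma> - z)"
    define y where "y = (\<lambda>n. \<sigma> - (1 - inverse (real (Suc n))) *\<^sub>R (\<sigma> - z))"
    have "y n \<in> state_ball p \<sigma> \<epsilon>" for n
    proof -
      define t where "t = 1 - inverse (real (Suc n))"
      have t: "0 \<le> t" "t < 1" by (simp_all add: t_def inverse_eq_divide)
      have y: "y n = (1 - t) *\<^sub>R \<sigma> + t *\<^sub>R z" unfolding y_def t_def[symmetric] by (simp add: algebra_simps)
      have "y n \<in> states" unfolding y using convexD_alt[OF convex_states \<sigma> z(1)] t by simp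
      moreover have "schatten_norm p (\<sigma> - y n) < \<epsilon>"
      proof -
        have "schatten_norm p (\<sigma> - y n) = t * schatten_norm p (\<sigma> - z)"
          using schatten_norm_scaleR[OF herm t(1)] p unfolding y_def t_def[symmetric] by simp
        also have "\<dots> \<le> t * \<epsilon>" using * t by (intro mult_left_mono) auto
        also have "\<dots> < \<epsilon>" using t \<epsilon> by simp
        finally show ?thesis .
      qed
      ultimately show ?thesis by (simp add: state_ball_def)
    qed
    moreover have "y \<longlonglongrightarrow> z"
    proof -
      have "y \<longlonglongrightarrow> \<sigma> - (1 - 0) *\<^sub>R (\<sigma> - z)"
        unfolding y_def by (intro tendsto_intros LIMSEQ_inverse_real_of_nat)
      then show ?thesis by simp
    qed
    ultimately show False using z(2) unfolding closure_sequential by blast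
  qed
  then have "\<epsilon> powr p < (trace_power p (\<sigma> - z) powr (1 / p)) powr p"
    unfolding schatten_norm_trace_power using p \<epsilon> by (intro powr_less_mono2) auto
  also have "\<dots> = trace_power p (\<sigma> - z)"
    using p trace_power_nonneg[OF herm, of p] by (simp add: powr_powr)
  also have "\<dots> = trace_power p (z - \<sigma>)"
    using trace_power_uminus[OF herm, of p] by simp
  finally show thesis using z that by (simp add: exterior_def)
qed

text \<open>Comparing the trace power with the Frobenius norm through
  \<open>trace_power_le_norm\<close> gives the explicit radius
  \<open>\<epsilon> / N powr (1 / p)\<close>.\<close>

lemma exterior_separated:
  fixes \<sigma> :: "'n::finite op"
  assumes p: "1 < p" and \<epsilon>: "0 < \<epsilon>" and \<sigma>: "\<sigma> \<in> states"
  obtains \<delta> where "0 < \<delta>" "\<And>z. z \<in> exterior p \<sigma> \<epsilon> \<Longrightarrow> \<delta> \<le> norm (z - \<sigma>)"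
proof -
  define N where "N = real CARD('n)"
  define \<delta> where "\<delta> = \<epsilon> / N powr (1 / p)"
  have N: "0 < N" by (simp add: N_def)
  have "\<delta> \<le> norm (z - \<sigma>)" if z: "z \<in> exterior p \<sigma> \<epsilon>" for z
  proof (rule ccontr)
    assume "\<not> \<delta> \<le> norm (z - \<sigma>)"
    then have "norm (z - \<sigma>) powr p \<le> \<delta> powr p" using p by (intro powr_mono2) auto
    also have "\<delta> powr p = \<epsilon> powr p / N"
      using \<epsilon> N p by (simp add: \<delta>_def powr_divide powr_powr)
    finally have "N * norm (z - \<sigma>) powr p \<le> \<epsilon> powr p" using N by (simp add: field_simps)
    moreover have "trace_power p (z - \<sigma>) \<le> N * norm (z - \<sigma>) powr p"
      unfolding N_def using z \<sigma> p
      by (intro trace_power_le_norm) (auto simp: exterior_def hermitian_diff states_hermitian)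
    ultimately show False using z by (simp add: exterior_def)
  qed
  moreover have "0 < \<delta>" using \<epsilon> N by (simp add: \<delta>_def)
  ultimately show thesis using that by blast
qed

text \<open>A weak solution is not assumed to preserve Hermiticity, and no uniqueness is invoked. As
  each generator commutes with \<open>adj\<close>, the Hermitian part of the trajectory solves the
  same integral equation.\<close>

lemma weak_solution_hermitian_part:
  fixes T :: "real \<Rightarrow> 'n::finite op \<Rightarrow> 'n op" and x :: "real \<Rightarrow> 'n op"
  assumes sol: "weak_solution L T" and L: "\<And>t. 0 \<le> t \<Longrightarrow> lindbladian (L t)" and \<rho>: "hermitian \<rho>"
    and x_def: "x = (\<lambda>t. (1/2) *\<^sub>R (T t \<rho> + adj (T t \<rho>)))" and t: "0 \<le> t"
  shows "hermitian (x t)" "(\<lambda>s. L s (x s)) integrable_on {0..t}"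
    "x t = \<rho> + integral {0..t} (\<lambda>s. L s (x s))"
proof -
  define G where "G = (\<lambda>s. L s (T s \<rho>))"
  have G: "G integrable_on {0..t}" and T: "T t \<rho> = \<rho> + integral {0..t} G"
    using sol t by (auto simp: weak_solution_def G_def intro: set_lebesgue_integral_eq_integral(1))
  show "hermitian (x t)" by (simp add: x_def hermitian_def adj_add adj_scaleR add.commute)
  have H: "((\<lambda>s. (1/2) *\<^sub>R (G s + adj (G s))) has_integral
      (1/2) *\<^sub>R (integral {0..t} G + adj (integral {0..t} G))) {0..t}"
    using has_integral_linear[OF integrable_integral[OF G] bounded_linear_adj] integrable_integral[OF G]
    by (intro has_integral_cmul has_integral_add) (auto simp: o_def)
  have eq: "(1/2) *\<^sub>R (G s + adj (G s)) = L s (x s)" if "s \<in> {0..t}" for s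
  proof -
    have lin: "linear (L s)" and "L s (adj (T s \<rho>)) = adj (L s (T s \<rho>))"
      using L[of s] that linear_lindbladian lindbladian_adj by auto
    then show ?thesis by (simp add: x_def G_def linear_add[OF lin] linear_scale[OF lin])
  qed
  have H': "((\<lambda>s. L s (x s)) has_integral (1/2) *\<^sub>R (integral {0..t} G + adj (integral {0..t} G))) {0..t}"
    using has_integral_eq[OF eq H] .
  then show "(\<lambda>s. L s (x s)) integrable_on {0..t}" by blast
  have "x t = \<rho> + (1/2) *\<^sub>R (integral {0..t} G + adj (integral {0..t} G))"
    using \<rho> by (simp add: x_def T adj_add hermitian_def scaleR_add_right flip: scaleR_left.add)
  then show "x t = \<rho> + integral {0..t} (\<lambda>s. L s (x s))"
    using integral_unique[OF H'] by simp
qed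

theorem theorem4p6:
  fixes p :: real
    and K :: "(complex^'n::finite^'n \<Rightarrow> complex^'n^'n) set"
    and \<sigma> :: "complex^'n^'n"
  assumes "1 < p"
    and "K \<subseteq> {L. lindbladian L}"
    and "\<sigma> \<in> states"
    and "\<exists>\<epsilon>>0. closure (state_ball p \<sigma> \<epsilon>) \<subset> states \<and>
           (\<forall>\<eta>\<in>state_sphere p \<sigma> \<epsilon>. \<forall>L\<in>K.
              0 \<le> Re (trace (L \<eta> ** signed_power p (\<eta> - \<sigma>))))"
  shows "\<not> reaches K \<sigma>"
proof
  assume "reaches K \<sigma>"
  note p = assms(1) and \<sigma> = assms(3)
  obtain \<epsilon> where \<epsilon>: "0 < \<epsilon>" and cl: "closure (state_ball p \<sigma> \<epsilon>) \<subset> states"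
    and out: "\<And>\<eta> L. L \<in> K \<Longrightarrow> \<eta> \<in> state_sphere p \<sigma> \<epsilon> \<Longrightarrow> 0 \<le> Re (trace (L \<eta> ** signed_power p (\<eta> - \<sigma>)))"
    using assms(4) by blast
  define E where "E = exterior p \<sigma> \<epsilon>"
  obtain \<rho> where \<rho>: "\<rho> \<in> E" using exterior_nonempty[OF p \<epsilon> \<sigma> cl] unfolding E_def .
  have E_herm: "hermitian z" if "z \<in> E" for z
    using that by (simp add: E_def exterior_def states_hermitian)
  have "\<rho> \<in> states" using \<rho> by (simp add: E_def exterior_def)
  then obtain T L where L: "\<And>t. 0 \<le> t \<Longrightarrow> L t \<in> K" and sol: "weak_solution L T"
    and lim: "((\<lambda>t. T t \<rho>) \<longlongrightarrow> \<sigma>) at_top"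
    using \<open>reaches K \<sigma>\<close> unfolding reaches_def admissible_def by blast
  have lind: "lindbladian (L t)" if "0 \<le> t" for t using L[OF that] assms(2) by blast
  define x where "x = (\<lambda>t. (1/2) *\<^sub>R (T t \<rho> + adj (T t \<rho>)))"
  define g where "g = (\<lambda>s. L s (x s))"
  have sol_x: "hermitian (x t)" "g integrable_on {0..t}" "x t = \<rho> + integral {0..t} g" if "0 \<le> t" for t
    unfolding g_def
    by (rule weak_solution_hermitian_part[OF sol _ E_herm[OF \<rho>] x_def that], rule lind, assumption)+
  have x_int: "integral {a..b} g = x b - x a" if "0 \<le> a" "a \<le> b" for a b
  proof -
    have "integral {0..a} g + integral {a..b} g = integral {0..b} g"
      using that sol_x(2)[of b] by (intro Henstock_Kurzweil_Integration.integral_combine) auto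
    with that show ?thesis using sol_x(3)[of a] sol_x(3)[of b] by (simp add: algebra_simps)
  qed
  define N where "N = real CARD('n)"
  have N: "0 < N" by (simp add: N_def)
  have gap0: "gap E (x t) \<le> 0" if t: "0 \<le> t" for t
  proof -
    have "continuous_on {0..t} (\<lambda>s. \<rho> + integral {0..s} g)"
      using sol_x(2)[OF t] by (intro continuous_intros indefinite_integral_continuous_1)
    then have cont: "continuous_on {0..t} x"
      by (rule continuous_on_eq) (use sol_x(3) in auto)
    have "bounded (x ` {0..t})"
      using cont by (intro compact_imp_bounded compact_continuous_image) auto
    then obtain M where M: "0 < M" "\<And>s. s \<in> {0..t} \<Longrightarrow> norm (x s) \<le> M"
      by (auto simp: bounded_pos)
    \<comment> \<open>Step lengths and bounds on \<open>L s\<close> may vary arbitrarily with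
      \<open>s\<close> here; the gauge absorbs this.\<close>
    have "gap E (x t) \<le> gap E (x 0)"
    proof (rule mono_of_henstock_increments[OF sol_x(2)[OF t] t, of N])
      show "0 \<le> N" using N by simp
      fix s e :: real assume s: "s \<in> {0..t}" and e: "0 < e"
      have Ls: "lindbladian (L s)" and lin: "linear (L s)"
        using lind[of s] s linear_lindbladian by auto
      obtain k where k: "0 \<le> k" "\<And>z. norm (L s z) \<le> k * norm z" using linear_bound[OF lin] by metis
      obtain r C where r: "0 < r" and C: "0 \<le> C" and inv: "\<And>h z. 0 \<le> h \<Longrightarrow> h \<le> r \<Longrightarrow> z \<in> E \<Longrightarrow>
          \<exists>\<Phi>. stochastic_map \<Phi> \<and> \<Phi> z \<in> E \<and>
            (\<forall>y. hermitian y \<longrightarrow> norm (\<Phi> y - (y + h *\<^sub>R L s y)) \<le> C * h\<^sup>2 * norm y)"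
        using exterior_invariant_step[OF p \<epsilon> \<sigma> Ls out[OF L]] s unfolding E_def by auto
      \<comment> \<open>Two errors of size \<open>h * c\<close> enter \<open>q\<close>, and
        \<open>gap_step\<close> multiplies them by \<open>N\<close>, which makes
        \<open>e * h\<close> in total.\<close>
      define c where "c = e / (2 * N)"
      have c: "0 < c" using e N by (simp add: c_def)
      obtain \<delta> where \<delta>: "0 < \<delta>" "\<And>a. a \<in> {0..t} \<Longrightarrow> dist a s < \<delta> \<Longrightarrow> norm (x a - x s) < c / (k + 1)"
        using cont[unfolded continuous_on_iff] s c k(1) unfolding dist_norm[of "x _"]
        by (metis add_nonneg_pos divide_pos_pos zero_less_one)
      \<comment> \<open>The entries serve the invariant step, the continuity of \<open>x\<close> at
        \<open>s\<close>, and the second-order error along a trajectory bounded by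
        \<open>M\<close>.\<close>
      define r' where "r' = min r (min \<delta> (c / (C * M + 1)))"
      have CM: "0 \<le> C * M" using C M by simp
      have "0 < r'" using r \<delta> c CM by (simp add: r'_def)
      moreover have "gap E (x b) \<le> gap E (x a) + e * (b - a) + N * norm ((b - a) *\<^sub>R g s - integral {a..b} g)"
        if ab: "0 \<le> a" "a \<le> s" "s \<le> b" "b \<le> t" "b - a < r'" for a b
      proof -
        define h where "h = b - a"
        have h: "0 \<le> h" "h \<le> r" "h < \<delta>" "h < c / (C * M + 1)"
          using ab by (auto simp: h_def r'_def)
        define err where "err = h *\<^sub>R g s - integral {a..b} g"
        define q where "q = norm err + h * c + h * c"
        have "h * norm (L s (x s - x a)) \<le> h * c"
        proof (rule mult_left_mono)
          have "norm (x s - x a) < c / (k + 1)"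
            using \<delta>(2)[of a] ab h by (simp add: norm_minus_commute dist_real_def h_def)
          then have "norm (L s (x s - x a)) \<le> k * (c / (k + 1))"
            using k by (meson less_imp_le mult_left_mono order_trans)
          also have "\<dots> \<le> c" using k c by (simp add: field_simps)
          finally show "norm (L s (x s - x a)) \<le> c" .
        qed (use h in simp)
        moreover have "C * h\<^sup>2 * norm (x a) \<le> h * c"
        proof -
          have "C * h\<^sup>2 * norm (x a) \<le> C * h\<^sup>2 * M"
            using M(2)[of a] ab C by (intro mult_left_mono) auto
          also have "\<dots> = h * (h * (C * M))" by (simp add: power2_eq_square)
          also have "\<dots> \<le> h * c"
          proof (rule mult_left_mono)
            have "h * (C * M) \<le> c / (C * M + 1) * (C * M)" using h CM by (intro mult_right_mono) auto
            also have "\<dots> \<le> c" using CM c by (simp add: field_simps)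
            finally show "h * (C * M) \<le> c" .
          qed (use h in simp)
          finally show ?thesis .
        qed
        moreover have "norm (x b - \<Phi> (x a)) \<le> norm err + h * norm (L s (x s - x a))
            + norm (\<Phi> (x a) - (x a + h *\<^sub>R L s (x a)))" for \<Phi>
        proof -
          have "x b - \<Phi> (x a) = - err + h *\<^sub>R L s (x s - x a) - (\<Phi> (x a) - (x a + h *\<^sub>R L s (x a)))"
            using x_int[of a b] ab by (simp add: err_def g_def linear_diff[OF lin] algebra_simps)
          also have "norm \<dots> \<le> norm (- err) + norm (h *\<^sub>R L s (x s - x a))
              + norm (\<Phi> (x a) - (x a + h *\<^sub>R L s (x a)))"
            by (intro order_trans[OF norm_triangle_ineq4] add_mono norm_triangle_ineq order_refl)
          finally show ?thesis using h by simp
        qed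
        ultimately have dist: "norm (x b - \<Phi> (x a)) \<le> q"
          if "norm (\<Phi> (x a) - (x a + h *\<^sub>R L s (x a))) \<le> C * h\<^sup>2 * norm (x a)" for \<Phi>
          using that unfolding q_def by (smt (verit))
        have "\<exists>\<Phi>. stochastic_map \<Phi> \<and> \<Phi> z \<in> E \<and> norm (x b - \<Phi> (x a)) \<le> q" if "z \<in> E" for z
          using inv[OF h(1,2) that] sol_x(1)[of a] ab dist by blast
        then have "gap E (x b) \<le> gap E (x a) + CARD('n) * q"
          using E_herm \<rho> sol_x(1)[of a] sol_x(1)[of b] ab by (intro gap_step) auto
        also have "CARD('n) * q = e * h + N * norm err"
          using N by (simp add: q_def N_def[symmetric] c_def field_simps)
        finally show ?thesis by (simp add: h_def err_def)
      qed
      ultimately show "\<exists>r>0. \<forall>a b. 0 \<le> a \<and> a \<le> s \<and> s \<le> b \<and> b \<le> t \<and> b - a < r \<longrightarrow>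
          gap E (x b) \<le> gap E (x a) + e * (b - a) + N * norm ((b - a) *\<^sub>R g s - integral {a..b} g)"
        by blast
    qed
    also have "x 0 = \<rho>" using sol_x(3)[of 0] by simp
    also have "gap E \<rho> \<le> 0" using gap_self[OF \<rho>] .
    finally show ?thesis .
  qed
  obtain \<delta> where \<delta>: "0 < \<delta>" "\<And>z. z \<in> E \<Longrightarrow> \<delta> \<le> norm (z - \<sigma>)"
    using exterior_separated[OF p \<epsilon> \<sigma>] unfolding E_def by metis
  have "((\<lambda>t. x t) \<longlongrightarrow> (1/2) *\<^sub>R (\<sigma> + adj \<sigma>)) at_top"
    unfolding x_def by (intro tendsto_intros lim bounded_linear.tendsto[OF bounded_linear_adj])
  also have "(1/2) *\<^sub>R (\<sigma> + adj \<sigma>) = \<sigma>"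
    using states_hermitian[OF \<sigma>] by (simp add: hermitian_def flip: scaleR_2)
  finally have "eventually (\<lambda>t. dist (x t) \<sigma> < \<delta> / 2) at_top"
    using \<delta>(1) by (intro tendstoD) auto
  then have "eventually (\<lambda>t. dist (x t) \<sigma> < \<delta> / 2 \<and> 0 \<le> t) at_top"
    by (intro eventually_conj eventually_ge_at_top)
  then obtain t where t: "dist (x t) \<sigma> < \<delta> / 2" "0 \<le> t"
    using eventually_happens[of _ at_top] by force
  have "gap_values E (x t) \<noteq> {}"
    using \<rho> E_herm sol_x(1)[OF t(2)] by (intro gap_values_nonempty hermitian_diff)
  \<comment> \<open>Both \<sigma> and a point of \<open>E\<close> are now within
    \<open>\<delta> / 2\<close> of \<open>x t\<close>, against the separation by
    \<open>\<delta>\<close>.\<close>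
  then obtain z where "z \<in> E" "norm (x t - z) < \<delta> / 2"
    using near_of_gap[OF gap0[OF t(2)], of "\<delta> / 2"] \<delta>(1) by auto
  then show False
    using \<delta>(2)[of z] t(1) norm_triangle_ineq[of "z - x t" "x t - \<sigma>"]
    by (simp add: dist_norm norm_minus_commute)
qed

end
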